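(* Let $p\in(0,1)$ be fixed (independent of $n$). For almost all graphs $G$ in the Erdős–Rényi model $G_{n,p}$, the energy of the Lanzhou matrix $LZ(G)$ satisfies $$\mathscr{E}(LZ(G))=(1+o(1))\frac{16}{3\pi}\cdot[p(1-p)]^{3/2}\cdot n^{7/2}.$$
   Context: $G_{n,p}$ is the model of random simple graphs on vertex set $\{1,\dots,n\}$ in which each edge is present independently with probability $p$; $d_i$ is the degree of vertex $i$ in $G=(V,E)$. $LZ(G)$ is the $n\times n$ matrix with $(i,j)$-entry $(n-1)(d_i+d_j)-(d_i^2+d_j^2)$ if $ij\in E$ and $0$ otherwise. The energy of a real symmetric matrix $A$ with eigenvalues $\lambda_1,\dots,\lambda_n$ is $\mathscr{E}(A)=\sum_{i=1}^n|\lambda_i|$. "Almost all" means with probability tending to $1$ as $n\to\infty$; thus "for almost all graphs, $\mathscr{E}=(1+o(1))g(n)$" means that for every $\varepsilon>0$, $\Pr(|\mathscr{E}/g(n)-1|>\varepsilon)\to0$ as $n\to\infty$. *)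

theory Defs
  imports "HOL-Probability.Probability" "Jordan_Normal_Form.Char_Poly"
begin

(* A simple graph on the vertex set {1..n} is represented by its edge set, a subset of vertex_pairs n. *)

definition vertex_pairs :: "nat \<Rightarrow> nat set set" where
  "vertex_pairs n = {e. e \<subseteq> {1..n} \<and> card e = 2}"

definition Gnp :: "nat \<Rightarrow> real \<Rightarrow> nat set set pmf" where
  "Gnp n p = map_pmf (\<lambda>f. {e \<in> vertex_pairs n. f e})
     (Pi_pmf (vertex_pairs n) False (\<lambda>_. bernoulli_pmf p))"

definition degree_in :: "nat set set \<Rightarrow> nat \<Rightarrow> nat" where
  "degree_in E i = card {e \<in> E. i \<in> e}"

(* Matrix indices start at 0, so index i belongs to the vertex Suc i. *)
definition lanzhou_matrix :: "nat \<Rightarrow> nat set set \<Rightarrow> real mat" where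
  "lanzhou_matrix n E = mat n n (\<lambda>(i, j).
     let u = Suc i; v = Suc j; d = (\<lambda>w. real (degree_in E w)) in
     if {u, v} \<in> E then (real n - 1) * (d u + d v) - ((d u)\<^sup>2 + (d v)\<^sup>2) else 0)"

(* proots lists the real roots of the characteristic polynomial with multiplicity. Meant for
   real symmetric matrices, where these are all n eigenvalues. *)
definition matrix_energy :: "real mat \<Rightarrow> real" where
  "matrix_energy A = (\<Sum>x\<in>#proots (char_poly A). \<bar>x\<bar>)"

end

theory Submission
  imports Defs "Jordan_Normal_Form.Spectral_Radius" "HOL-Real_Asymp.Real_Asymp"
begin

text \<open>
  With \<open>m = n - 1\<close>, an edge between vertices of degrees \<open>d\<close> and \<open>d'\<close> has weight
  \<open>d (m - d) + d' (m - d')\<close>.  Degrees concentrate around \<open>m p\<close>, so every edge weight is close to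
  \<open>K = 2 m\<^sup>2 p (1 - p)\<close>, and the Lanzhou matrix is close to \<open>K\<close> times the adjacency matrix.  Removing the
  mean \<open>p\<close> of the off-diagonal entries leaves \<open>K \<sqrt>n\<close> times the Wigner matrix \<open>X\<close> with entries
  \<open>(1\<^sub>e - p) / \<sqrt>n\<close>.  The sum of the absolute eigenvalues changes under such a replacement by at most \<open>\<sqrt>n\<close>
  times the Frobenius norm of the fluctuating part of the difference, plus the sum of the absolute
  eigenvalues of its structured part (\<open>sum_abs_eigenvalues_perturbation\<close>); here both are at most of
  order \<open>n\<^sup>3\<close> in mean, which is negligible against \<open>n powr (7/2)\<close> (\<open>lanzhou_energy_approximation\<close>,
  \<open>expectation_degree_deviation\<close>).  It remains to see that the mean of \<open>\<bar>\<lambda>\<bar>\<close> over the eigenvalues of \<open>X\<close> tends to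
  \<open>8 \<sigma> / (3 \<pi>)\<close>, the mean absolute value of the semicircle law of variance \<open>\<sigma>\<^sup>2 = p (1 - p)\<close>.

  This is done without moments or weak convergence.  Coulson's formula
  \<open>\<bar>x\<bar> = (2 / \<pi>) \<integral> x\<^sup>2 / (x\<^sup>2 + t\<^sup>2) dt\<close> over \<open>t > 0\<close> expresses the mean of \<open>\<bar>\<lambda>\<bar>\<close> as
  \<open>(2 / \<pi>) \<integral> (1 - t Im s(t)) dt\<close>, where \<open>s(t)\<close> is the normalized trace of the resolvent
  \<open>R = (X - i t)\<^sup>-\<^sup>1\<close>.  The integrand is dominated by \<open>2 / (1 + t\<^sup>2)\<close>, so pointwise convergence in mean of \<open>s(t)\<close>
  suffices (\<open>expectation_mean_abs_eigenvalue_tendsto\<close>).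

  For fixed \<open>t\<close>, the residual \<open>Q = 1 + i t s + \<sigma>\<^sup>2 s\<^sup>2\<close> is small in mean square
  (\<open>expectation_loop_residual\<close>).  The identity \<open>X R = 1 + i t R\<close> writes \<open>1 + i t s\<close> as the mean over \<open>i\<close> of
  \<open>\<Sum>\<^sub>j X\<^sub>i\<^sub>j R\<^sub>j\<^sub>i\<close>.  A Bernoulli variable satisfies an exact integration by parts, replacing the factor
  \<open>1\<^sub>e - p\<close> by \<open>p (1 - p)\<close> times a difference of the remaining factor with and without the edge
  (\<open>expectation_Gnp_by_parts\<close>).  Toggling an edge is a rank two change, and by the resolvent identity it
  changes \<open>R\<^sub>j\<^sub>i\<close> by about \<open>- R\<^sub>i\<^sub>i R\<^sub>j\<^sub>j / \<sqrt>n\<close> (\<open>edge_derivative_estimate\<close>); summed over \<open>i\<close> and \<open>j\<close> this gives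
  \<open>- \<sigma>\<^sup>2 s\<^sup>2\<close>.  Testing the equation against the conjugate of \<open>Q\<close> itself yields the second moment of \<open>Q\<close>
  directly, which settles the concentration of \<open>s\<close> at the same time; it works because toggling an edge moves
  \<open>Q\<close> only by \<open>O(n powr (-3/2))\<close>.  Finally the quadratic has one root on each side of the real axis and \<open>Im s \<ge> 0\<close>, hence \<open>s\<close>
  lies within \<open>\<bar>Q\<bar> / t\<close> of the upper root (\<open>semicircle_transform_stability\<close>), whose integral is elementary.
\<close>

unbundle no vec_syntax

section \<open>Diagonalization of real symmetric matrices\<close>

lemma sum_kronecker_delta:
  fixes f :: "nat \<Rightarrow> 'a :: semiring_1"
  assumes "i < n"
  shows "(\<Sum>k<n. of_bool (k = i) * f k) = f i" "(\<Sum>k<n. of_bool (i = k) * f k) = f i"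
    "(\<Sum>k<n. f k * of_bool (k = i)) = f i" "(\<Sum>k<n. f k * of_bool (i = k)) = f i"
  using assms by (subst sum.remove[of _ i]; auto)+

text \<open>The quadratic form of a complex eigenvector is real by symmetry, so the eigenvalue is a real root of
  the characteristic polynomial and hence also has a real eigenvector.\<close>

lemma symmetric_mat_real_eigenvalue:
  fixes A :: "real mat"
  assumes A: "A \<in> carrier_mat n n" and sym: "A\<^sup>T = A" and n: "n > 0"
  obtains e where "eigenvalue A e"
proof -
  let ?c = "complex_of_real"
  define C where "C = map_mat ?c A"
  have C: "C \<in> carrier_mat n n" using A by (simp add: C_def)
  obtain z where "eigenvalue C z"
    using spectrum_non_empty[OF C n] by (auto simp: spectrum_def)
  then obtain w where w: "w \<in> carrier_vec n" "w \<noteq> 0\<^sub>v n" and Cw: "C *\<^sub>v w = z \<cdot>\<^sub>v w"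
    using C by (auto simp: eigenvalue_def eigenvector_def)
  have entry: "C $$ (i,j) = ?c (A $$ (i,j))" if "i < n" "j < n" for i j
    using A that by (simp add: C_def)
  have symA: "A $$ (i,j) = A $$ (j,i)" if "i < n" "j < n" for i j
    using A that sym by (metis carrier_matD index_transpose_mat(1))
  have ev: "(\<Sum>j<n. ?c (A $$ (i,j)) * w $ j) = z * w $ i" if "i < n" for i
  proof -
    have "(C *\<^sub>v w) $ i = (\<Sum>j<n. ?c (A $$ (i,j)) * w $ j)"
      using C w that by (auto simp: scalar_prod_def entry lessThan_atLeast0 intro!: sum.cong)
    thus ?thesis using Cw w that by simp
  qed
  define s where "s = (\<Sum>i<n. cnj (w $ i) * w $ i)"
  define h where "h = (\<Sum>i<n. \<Sum>j<n. cnj (w $ i) * (?c (A $$ (i,j)) * w $ j))"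
  have h: "h = z * s"
    by (simp add: h_def s_def sum_distrib_left[symmetric] ev)
      (simp add: sum_distrib_left mult_ac)
  have "cnj h = (\<Sum>i<n. \<Sum>j<n. cnj (w $ j) * (?c (A $$ (j,i)) * w $ i))"
    using symA by (auto simp: h_def mult_ac intro!: sum.cong)
  also have "\<dots> = h" unfolding h_def by (rule sum.swap)
  finally have h_real: "cnj h = h" .
  have s_real: "s = ?c (\<Sum>i<n. (cmod (w $ i))\<^sup>2)"
    unfolding s_def of_real_sum by (intro sum.cong refl) (metis complex_norm_square mult.commute of_real_power)
  have "s \<noteq> 0"
  proof
    assume "s = 0"
    hence "(\<Sum>i<n. (cmod (w $ i))\<^sup>2) = 0" unfolding s_real of_real_eq_0_iff .
    hence "\<forall>i<n. w $ i = 0" by (subst (asm) sum_nonneg_eq_0_iff) auto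
    hence "w = 0\<^sub>v n" using w(1) by auto
    with w(2) show False by simp
  qed
  hence "cnj z = z" using h h_real s_real
    by (metis complex_cnj_complex_of_real complex_cnj_mult mult_right_cancel)
  then obtain e where e: "z = ?c e" by (metis Reals_cases Reals_cnj_iff)
  have "poly (char_poly C) z = 0"
    using \<open>eigenvalue C z\<close> eigenvalue_root_char_poly[OF C] by simp
  hence "?c (poly (char_poly A) e) = 0"
    by (simp add: C_def of_real_hom.char_poly_hom[OF A] e of_real_hom.poly_map_poly)
  hence "eigenvalue A e" using eigenvalue_root_char_poly[OF A] by simp
  thus thesis by (rule that)
qed

text \<open>A reflection exchanging the unit vector \<open>v\<close> with the first standard vector provides an orthogonal
  matrix with first column \<open>v\<close>, without extending \<open>v\<close> to a basis.\<close>

lemma householder: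
  fixes v :: "real vec"
  assumes v: "v \<in> carrier_vec n" and unit: "(\<Sum>i<n. (v $ i)\<^sup>2) = 1" and n: "n > 0"
  obtains W where "W \<in> carrier_mat n n" "W\<^sup>T = W" "W * W = 1\<^sub>m n" "\<And>i. i < n \<Longrightarrow> W $$ (i,0) = v $ i"
proof -
  define w where "w i = v $ i - of_bool (i = 0)" for i
  define r where "r = (\<Sum>i<n. w i * w i)"
  \<comment> \<open>For the first standard vector \<open>v\<close> this is \<open>2 / 0 = 0\<close>, which makes \<open>W\<close> the identity.\<close>
  define c where "c = 2 / r"
  define W where "W = mat n n (\<lambda>(i,j). of_bool (i = j) - c * w i * w j)"
  have r: "r = - 2 * w 0"
  proof -
    have "r = (\<Sum>i<n. (v $ i)\<^sup>2 + (1 - 2 * v $ i) * of_bool (i = 0))"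
      unfolding r_def w_def by (intro sum.cong) (auto simp: power2_eq_square algebra_simps)
    also have "\<dots> = 1 + (1 - 2 * v $ 0)"
      using n by (simp only: sum.distrib unit sum_kronecker_delta)
    finally show ?thesis by (simp add: w_def)
  qed
  have cr: "c * (c * r) = 2 * c" by (simp add: c_def)
  show thesis
  proof (rule that)
    show W: "W \<in> carrier_mat n n" by (simp add: W_def)
    show "W\<^sup>T = W" by (rule eq_matI) (auto simp: W_def)
    show "W * W = 1\<^sub>m n"
    proof (rule eq_matI)
      fix i j assume "i < dim_row (1\<^sub>m n :: real mat)" "j < dim_col (1\<^sub>m n :: real mat)"
      hence ij: "i < n" "j < n" by auto
      have "(W * W) $$ (i,j) = (\<Sum>k<n. (of_bool (i = k) - c * w i * w k) * (of_bool (k = j) - c * w k * w j))"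
        using ij by (simp add: W_def scalar_prod_def lessThan_atLeast0)
      also have "\<dots> = (\<Sum>k<n. of_bool (i = k) * of_bool (k = j)) - c * w j * (\<Sum>k<n. of_bool (i = k) * w k)
          - c * w i * (\<Sum>k<n. of_bool (k = j) * w k) + c * c * w i * w j * r"
        by (simp add: r_def algebra_simps sum.distrib sum_subtractf sum_distrib_left
            del: sum_mult_of_bool_eq sum_of_bool_mult_eq)
      also have "\<dots> = of_bool (i = j) - 2 * c * w i * w j + c * (c * r) * w i * w j"
        using ij by (simp only: sum_kronecker_delta) (simp add: algebra_simps)
      finally show "(W * W) $$ (i,j) = 1\<^sub>m n $$ (i,j)" using ij by (simp add: cr)
    qed (auto simp: W_def)
    show "W $$ (i,0) = v $ i" if "i < n" for i
    proof -
      have "c * w i * w 0 = - w i"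
      proof (cases "r = 0")
        case True
        hence "w i = 0" using that unfolding r_def by (subst (asm) sum_nonneg_eq_0_iff) auto
        thus ?thesis by simp
      qed (use r in \<open>auto simp: c_def field_simps\<close>)
      thus ?thesis using that n by (simp add: W_def w_def)
    qed
  qed
qed

text \<open>Conjugation with the reflection belonging to a unit eigenvector splits off a one-dimensional block;
  symmetry makes the remaining off-diagonal blocks vanish, and the induction continues with the
  smaller block.\<close>

lemma symmetric_mat_diagonalization:
  fixes A :: "real mat"
  assumes "A \<in> carrier_mat n n" and "A\<^sup>T = A"
  obtains U l where "U \<in> carrier_mat n n" "U * U\<^sup>T = 1\<^sub>m n"
    "A = U * mat n n (\<lambda>(i,j). if i = j then l i else 0) * U\<^sup>T"
  using assms
proof (induction n arbitrary: A thesis)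
  case 0
  show ?case by (rule 0(1)[of "1\<^sub>m 0"]) (use 0(2) in auto)
next
  case (Suc m)
  let ?n = "Suc m"
  note A = Suc.prems(2)
  obtain e where "eigenvalue A e"
    using symmetric_mat_real_eigenvalue[OF A Suc.prems(3)] by blast
  then obtain v0 where v0: "v0 \<in> carrier_vec ?n" "v0 \<noteq> 0\<^sub>v ?n" "A *\<^sub>v v0 = e \<cdot>\<^sub>v v0"
    using A by (auto simp: eigenvalue_def eigenvector_def)
  define r where "r = (\<Sum>i<?n. (v0 $ i)\<^sup>2)"
  have "r \<noteq> 0"
  proof
    assume "r = 0"
    hence "\<forall>i<?n. v0 $ i = 0" unfolding r_def by (subst (asm) sum_nonneg_eq_0_iff) auto
    thus False using v0 by auto
  qed
  moreover have "r \<ge> 0" unfolding r_def by (intro sum_nonneg) auto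
  ultimately have r: "r > 0" by simp
  define v where "v = (1 / sqrt r) \<cdot>\<^sub>v v0"
  have v: "v \<in> carrier_vec ?n" using v0 by (simp add: v_def)
  have Av: "A *\<^sub>v v = e \<cdot>\<^sub>v v"
    using v0 A by (auto simp: v_def mult_mat_vec[OF A v0(1)] smult_smult_assoc mult.commute)
  have "(\<Sum>i<?n. (v $ i)\<^sup>2) = (\<Sum>i<?n. (v0 $ i)\<^sup>2 / r)"
    using r v0(1) by (intro sum.cong) (auto simp: v_def power_mult_distrib power_divide)
  also have "\<dots> = 1" using r by (simp add: r_def sum_divide_distrib[symmetric])
  finally obtain W where W: "W \<in> carrier_mat ?n ?n" "W\<^sup>T = W" "W * W = 1\<^sub>m ?n"
    and W0: "\<And>i. i < ?n \<Longrightarrow> W $$ (i,0) = v $ i"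
    using householder[OF v, of thesis] by blast
  define A' where "A' = W * A * W"
  have A': "A' \<in> carrier_mat ?n ?n" using W A by (simp add: A'_def)
  have symA': "A'\<^sup>T = A'"
    using W A Suc.prems(3)
    by (simp add: A'_def transpose_mult[of _ ?n ?n _ ?n] assoc_mult_mat[of _ ?n ?n _ ?n _ ?n])
  have colW: "col W 0 = v" using W W0 v by auto
  have "col A' 0 = (W * A) *\<^sub>v col W 0"
    unfolding A'_def using W A by (intro col_mult2[of _ ?n ?n _ ?n]) auto
  also have "\<dots> = W *\<^sub>v (e \<cdot>\<^sub>v col W 0)"
    using W A v unfolding colW by (subst assoc_mult_mat_vec[of _ ?n ?n _ ?n]) (auto simp: Av)
  also have "\<dots> = e \<cdot>\<^sub>v (W *\<^sub>v col W 0)" using W v unfolding colW by (intro mult_mat_vec) auto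
  also have "W *\<^sub>v col W 0 = col (W * W) 0" using W by (intro col_mult2[symmetric]) auto
  also have "\<dots> = unit_vec ?n 0" using W by simp
  finally have col0: "col A' 0 = e \<cdot>\<^sub>v unit_vec ?n 0" .
  have A'0: "A' $$ (i,0) = (if i = 0 then e else 0)" if "i < ?n" for i
    using arg_cong[OF col0, of "\<lambda>x. x $ i"] A' that by simp
  have symA'_entry: "A' $$ (i,j) = A' $$ (j,i)" if "i < ?n" "j < ?n" for i j
    using A' that symA' by (metis carrier_matD index_transpose_mat(1))
  define A3 where "A3 = mat m m (\<lambda>(i,j). A' $$ (Suc i, Suc j))"
  have A3: "A3 \<in> carrier_mat m m" by (simp add: A3_def)
  have "A3\<^sup>T = A3" by (rule eq_matI) (use symA'_entry in \<open>auto simp: A3_def\<close>)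
  then obtain U l where U: "U \<in> carrier_mat m m" "U * U\<^sup>T = 1\<^sub>m m"
    and A3_eq: "A3 = U * mat m m (\<lambda>(i,j). if i = j then l i else 0) * U\<^sup>T"
    using Suc.IH[OF _ A3] by blast
  let ?D = "mat m m (\<lambda>(i,j). if i = j then l i else 0)"
  define l' where "l' i = (case i of 0 \<Rightarrow> e | Suc k \<Rightarrow> l k)" for i
  let ?D' = "mat ?n ?n (\<lambda>(i,j). if i = j then l' i else 0)"
  define T where "T = four_block_mat (1\<^sub>m 1) (0\<^sub>m 1 m) (0\<^sub>m m 1) U"
  have T: "T \<in> carrier_mat ?n ?n" using U by (auto simp: T_def)
  have TT: "T\<^sup>T = four_block_mat (1\<^sub>m 1) (0\<^sub>m 1 m) (0\<^sub>m m 1) (U\<^sup>T)"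
    unfolding T_def using U by (subst transpose_four_block_mat[of _ 1 1 _ m _ m]) auto
  have D': "?D' = four_block_mat (mat 1 1 (\<lambda>_. e)) (0\<^sub>m 1 m) (0\<^sub>m m 1) ?D"
    by (rule eq_matI) (auto simp: l'_def split: nat.split)
  have "T * ?D' = four_block_mat (mat 1 1 (\<lambda>_. e)) (0\<^sub>m 1 m) (0\<^sub>m m 1) (U * ?D)"
    unfolding T_def D' using U by (subst mult_four_block_mat[of _ 1 1 _ m _ m]) auto
  hence "T * ?D' * T\<^sup>T = four_block_mat (mat 1 1 (\<lambda>_. e)) (0\<^sub>m 1 m) (0\<^sub>m m 1) A3"
    unfolding TT A3_eq using U by (simp, subst mult_four_block_mat[of _ 1 1 _ m _ m]) auto
  also have "\<dots> = A'"
  proof (rule eq_matI)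
    fix i j assume ij: "i < dim_row A'" "j < dim_col A'"
    thus "four_block_mat (mat 1 1 (\<lambda>_. e)) (0\<^sub>m 1 m) (0\<^sub>m m 1) A3 $$ (i,j) = A' $$ (i,j)"
      using A' A3 A'0[of i] A'0[of j] symA'_entry[of i j] by (cases i; cases j) (auto simp: A3_def)
  qed (use A' A3 in auto)
  finally have TDT: "T * ?D' * T\<^sup>T = A'" .
  have TT1: "T * T\<^sup>T = 1\<^sub>m ?n"
    unfolding TT unfolding T_def using U by (subst mult_four_block_mat[of _ 1 1 _ m _ m]) auto
  note assoc = assoc_mult_mat[of _ ?n ?n _ ?n _ ?n]
  show ?case
  proof (rule Suc.prems(1)[of "W * T" l'])
    show "W * T \<in> carrier_mat ?n ?n" using W T by simp
    have "(W * T) * (W * T)\<^sup>T = W * (T * T\<^sup>T) * W"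
      using W T by (simp add: transpose_mult[of _ ?n ?n _ ?n] assoc)
    thus "(W * T) * (W * T)\<^sup>T = 1\<^sub>m ?n" using W by (simp add: TT1)
    have "(W * T) * ?D' * (W * T)\<^sup>T = W * (T * ?D' * T\<^sup>T) * W"
      using W T by (simp add: transpose_mult[of _ ?n ?n _ ?n] assoc mult_carrier_mat[of _ ?n ?n _ ?n])
    also have "\<dots> = (W * W) * A * (W * W)"
      using W(1) A by (simp add: TDT A'_def assoc mult_carrier_mat[of _ ?n ?n _ ?n])
    also have "\<dots> = A" using W(3) A by simp
    finally show "A = (W * T) * ?D' * (W * T)\<^sup>T" by simp
  qed
qed

text \<open>The dimension varies with the graph, so bases and matrices are functions of indices below \<open>n\<close>, and
  \<open>u k\<close> is the \<open>k\<close>-th vector.  Orthonormality of the rows and of the columns is recorded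
  together, which makes Parseval's identity available in either index.\<close>

definition orthonormal_basis :: "nat \<Rightarrow> (nat \<Rightarrow> nat \<Rightarrow> real) \<Rightarrow> bool" where
  "orthonormal_basis n u \<longleftrightarrow>
     (\<forall>k<n. \<forall>l<n. (\<Sum>i<n. u k i * u l i) = of_bool (k = l)) \<and>
     (\<forall>i<n. \<forall>j<n. (\<Sum>k<n. u k i * u k j) = of_bool (i = j))"

definition diagonalizes ::
    "nat \<Rightarrow> (nat \<Rightarrow> nat \<Rightarrow> real) \<Rightarrow> (nat \<Rightarrow> real) \<Rightarrow> (nat \<Rightarrow> nat \<Rightarrow> real) \<Rightarrow> bool" where
  "diagonalizes n a l u \<longleftrightarrow> orthonormal_basis n u \<and>
     (\<forall>i<n. \<forall>j<n. a i j = (\<Sum>k<n. l k * u k i * u k j))"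

text \<open>The two conclusions are combined because the eigenvalues of a matrix enter the energy with
  multiplicity, as roots of the characteristic polynomial, while all estimates below use the
  diagonalizing basis.\<close>

theorem symmetric_spectral_theorem:
  fixes a :: "nat \<Rightarrow> nat \<Rightarrow> real"
  assumes sym: "\<And>i j. i < n \<Longrightarrow> j < n \<Longrightarrow> a i j = a j i"
  obtains l u where "diagonalizes n a l u"
    "matrix_energy (mat n n (\<lambda>(i,j). a i j)) = (\<Sum>k<n. \<bar>l k\<bar>)"
proof -
  define A where "A = mat n n (\<lambda>(i,j). a i j)"
  have A: "A \<in> carrier_mat n n" by (simp add: A_def)
  have "A\<^sup>T = A" by (rule eq_matI) (auto simp: A_def sym)
  then obtain U l where U: "U \<in> carrier_mat n n" "U * U\<^sup>T = 1\<^sub>m n"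
    and A_eq: "A = U * mat n n (\<lambda>(i,j). if i = j then l i else 0) * U\<^sup>T"
    using symmetric_mat_diagonalization[OF A] by blast
  let ?D = "mat n n (\<lambda>(i,j). if i = j then l i else 0)"
  have U': "U\<^sup>T * U = 1\<^sub>m n" by (rule mat_mult_left_right_inverse[OF U(1) _ U(2)]) (use U in simp)
  have UD: "(U * ?D) $$ (i,k) = U $$ (i,k) * l k" if "i < n" "k < n" for i k
  proof -
    have "(U * ?D) $$ (i,k) = (\<Sum>x<n. U $$ (i,x) * (if x = k then l x else 0))"
      using U that by (simp add: scalar_prod_def lessThan_atLeast0)
    thus ?thesis using that by (simp add: if_distrib cong: if_cong)
  qed
  have "diagonalizes n a l (\<lambda>k i. U $$ (i,k))"
    unfolding diagonalizes_def orthonormal_basis_def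
  proof (intro conjI allI impI)
    fix i j assume ij: "i < n" "j < n"
    have "(U\<^sup>T * U) $$ (i,j) = (\<Sum>k<n. U $$ (k,i) * U $$ (k,j))"
      using U ij by (simp add: scalar_prod_def lessThan_atLeast0)
    thus "(\<Sum>k<n. U $$ (k,i) * U $$ (k,j)) = of_bool (i = j)"
      using U' ij by (cases "i = j") auto
    have "(U * U\<^sup>T) $$ (i,j) = (\<Sum>k<n. U $$ (i,k) * U $$ (j,k))"
      using U(1) ij by (simp add: scalar_prod_def lessThan_atLeast0)
    thus "(\<Sum>k<n. U $$ (i,k) * U $$ (j,k)) = of_bool (i = j)"
      using U ij by (cases "i = j") auto
    have "A $$ (i,j) = (\<Sum>k<n. (U * ?D) $$ (i,k) * U $$ (j,k))"
      unfolding A_eq using U ij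
      by (subst index_mult_mat(1)) (auto simp: scalar_prod_def lessThan_atLeast0 intro!: sum.cong)
    thus "a i j = (\<Sum>k<n. l k * U $$ (i,k) * U $$ (j,k))"
      using ij by (simp add: A_def UD mult.commute)
  qed
  moreover have "matrix_energy A = (\<Sum>k<n. \<bar>l k\<bar>)"
  proof -
    have "similar_mat_wit A ?D U (U\<^sup>T)"
      by (rule similar_mat_witI[of _ _ n]) (use A U U' A_eq in auto)
    hence "char_poly A = char_poly ?D"
      by (intro char_poly_similar) (auto simp: similar_mat_def)
    also have "\<dots> = (\<Prod>x\<leftarrow>diag_mat ?D. [:- x, 1:])"
      by (rule char_poly_upper_triangular[of _ n]) auto
    also have "diag_mat ?D = map l [0..<n]" by (auto simp: diag_mat_def)
    also have "(\<Prod>x\<leftarrow>\<dots>. [:- x, 1:]) = (\<Prod>k\<leftarrow>[0..<n]. [:- l k, 1:])"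
      by (simp add: o_def)
    also have "\<dots> = (\<Prod>k<n. [:- l k, 1:])"
      by (subst prod.distinct_set_conv_list[symmetric]) (auto simp: lessThan_atLeast0)
    finally have "proots (char_poly A) = (\<Sum>k<n. proots [:- l k, 1:])"
      by (simp add: proots_prod del: proots_linear_factor)
    moreover have "(\<Sum>x\<in>#(\<Sum>k<m. proots [:- l k, 1:]). \<bar>x\<bar>) = (\<Sum>k<m. \<bar>l k\<bar>)" for m
      by (induction m) auto
    ultimately show ?thesis by (simp add: matrix_energy_def)
  qed
  ultimately show thesis using that unfolding A_def by blast
qed

section \<open>Perturbing the sum of the absolute eigenvalues\<close>

lemma orthonormal_basisD:
  assumes "orthonormal_basis n u" "i < n" "j < n"
  shows "(\<Sum>k<n. u i k * u j k) = of_bool (i = j)" "(\<Sum>k<n. u k i * u k j) = of_bool (i = j)"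
  using assms by (auto simp: orthonormal_basis_def)

lemma sum_rotate:
  "(\<Sum>k\<in>K. \<Sum>i\<in>I. \<Sum>j\<in>J. f k i j) = (\<Sum>i\<in>I. \<Sum>j\<in>J. \<Sum>k\<in>K. f k i j)"
  by (subst sum.swap) (rule sum.cong[OF refl], rule sum.swap)

lemma parseval:
  assumes u: "orthonormal_basis n u"
  shows "(\<Sum>k<n. (\<Sum>i<n. u k i * x i)\<^sup>2) = (\<Sum>i<n. (x i)\<^sup>2)"
proof -
  have "(\<Sum>k<n. (\<Sum>i<n. u k i * x i)\<^sup>2) = (\<Sum>k<n. \<Sum>i<n. \<Sum>j<n. x i * x j * (u k i * u k j))"
    by (simp add: power2_eq_square sum_product mult_ac)
  also have "\<dots> = (\<Sum>i<n. \<Sum>j<n. x i * x j * (\<Sum>k<n. u k i * u k j))"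
    by (subst sum_rotate) (simp add: sum_distrib_left)
  also have "\<dots> = (\<Sum>i<n. \<Sum>j<n. x i * x j * of_bool (i = j))"
    by (intro sum.cong refl) (simp add: orthonormal_basisD[OF u])
  also have "\<dots> = (\<Sum>i<n. x i * x i)"
    by (intro sum.cong refl) (simp add: sum_kronecker_delta del: sum_mult_of_bool_eq)
  finally show ?thesis by (simp add: power2_eq_square)
qed

definition quad_form :: "nat \<Rightarrow> (nat \<Rightarrow> nat \<Rightarrow> real) \<Rightarrow> (nat \<Rightarrow> real) \<Rightarrow> real" where
  "quad_form n a v = (\<Sum>i<n. \<Sum>j<n. v i * a i j * v j)"

lemma quad_form_diagonalizes:
  assumes "diagonalizes n a l u"
  shows "quad_form n a v = (\<Sum>k<n. l k * (\<Sum>i<n. v i * u k i)\<^sup>2)"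
proof -
  have "quad_form n a v = (\<Sum>i<n. \<Sum>j<n. \<Sum>k<n. l k * ((v i * u k i) * (v j * u k j)))"
    using assms unfolding quad_form_def diagonalizes_def
    by (intro sum.cong refl) (simp add: sum_distrib_left sum_distrib_right mult_ac)
  also have "\<dots> = (\<Sum>k<n. l k * (\<Sum>i<n. v i * u k i)\<^sup>2)"
    unfolding power2_eq_square sum_product unfolding sum_distrib_left by (rule sum_rotate[symmetric])
  finally show ?thesis .
qed

lemma quad_form_eigenvector:
  assumes d: "diagonalizes n a l u" and k: "k < n"
  shows "quad_form n a (u k) = l k"
proof -
  have u: "orthonormal_basis n u" using d by (simp add: diagonalizes_def)
  have "quad_form n a (u k) = (\<Sum>m<n. l m * of_bool (k = m))"
    unfolding quad_form_diagonalizes[OF d]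
    by (intro sum.cong refl) (simp add: orthonormal_basisD[OF u k])
  thus ?thesis using k by (simp only: sum_kronecker_delta)
qed

text \<open>The weights \<open>(\<Sum>i. v m i * u k i)\<^sup>2\<close> form a doubly stochastic matrix, so the diagonal of \<open>a\<close> in any
  orthonormal basis is an average of the eigenvalues.\<close>

lemma sum_abs_quad_form_le:
  assumes d: "diagonalizes n a l u" and v: "orthonormal_basis n v"
  shows "(\<Sum>m<n. \<bar>quad_form n a (v m)\<bar>) \<le> (\<Sum>k<n. \<bar>l k\<bar>)"
proof -
  have u: "orthonormal_basis n u" using d by (simp add: diagonalizes_def)
  have "(\<Sum>m<n. \<bar>quad_form n a (v m)\<bar>) \<le> (\<Sum>m<n. \<Sum>k<n. \<bar>l k\<bar> * (\<Sum>i<n. v m i * u k i)\<^sup>2)"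
    unfolding quad_form_diagonalizes[OF d]
    by (intro sum_mono order_trans[OF sum_abs]) (simp add: abs_mult)
  also have "\<dots> = (\<Sum>k<n. \<bar>l k\<bar> * (\<Sum>m<n. (\<Sum>i<n. v m i * u k i)\<^sup>2))"
    by (subst sum.swap) (simp add: sum_distrib_left)
  also have "\<dots> = (\<Sum>k<n. \<bar>l k\<bar>)"
    unfolding parseval[OF v] by (intro sum.cong refl) (simp add: power2_eq_square orthonormal_basisD[OF u])
  finally show ?thesis .
qed

lemma quad_form_diff: "quad_form n (\<lambda>i j. a i j - b i j) v = quad_form n a v - quad_form n b v"
  by (simp add: quad_form_def algebra_simps sum_subtractf)

lemma quad_form_add: "quad_form n (\<lambda>i j. a i j + b i j) v = quad_form n a v + quad_form n b v"
  by (simp add: quad_form_def algebra_simps sum.distrib)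

lemma quad_form_cong:
  "(\<And>i j. i < n \<Longrightarrow> j < n \<Longrightarrow> a i j = b i j) \<Longrightarrow> quad_form n a v = quad_form n b v"
  by (simp add: quad_form_def)

text \<open>In the eigenbasis of \<open>a\<close> the diagonal of \<open>a\<close> attains the sum of the absolute eigenvalues, while that of
  \<open>b\<close> can only lose.  This is the triangle inequality for the trace norm, with the norm of the difference
  replaced by a bound over all orthonormal bases.\<close>

lemma sum_abs_eigenvalues_le:
  assumes a: "diagonalizes n a l u" and b: "diagonalizes n b l' u'"
    and N: "\<And>v. orthonormal_basis n v \<Longrightarrow> (\<Sum>m<n. \<bar>quad_form n (\<lambda>i j. a i j - b i j) (v m)\<bar>) \<le> N"
  shows "(\<Sum>k<n. \<bar>l k\<bar>) \<le> (\<Sum>k<n. \<bar>l' k\<bar>) + N"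
proof -
  have u: "orthonormal_basis n u" using a by (simp add: diagonalizes_def)
  have "(\<Sum>k<n. \<bar>l k\<bar>) = (\<Sum>k<n. \<bar>quad_form n b (u k) + quad_form n (\<lambda>i j. a i j - b i j) (u k)\<bar>)"
    using quad_form_eigenvector[OF a] by (simp add: quad_form_diff)
  also have "\<dots> \<le> (\<Sum>k<n. \<bar>quad_form n b (u k)\<bar> + \<bar>quad_form n (\<lambda>i j. a i j - b i j) (u k)\<bar>)"
    by (intro sum_mono abs_triangle_ineq)
  also have "\<dots> \<le> (\<Sum>k<n. \<bar>l' k\<bar>) + N"
    unfolding sum.distrib by (intro add_mono sum_abs_quad_form_le[OF b u] N[OF u])
  finally show ?thesis .
qed

text \<open>Two applications of the Cauchy-Schwarz inequality, the second over the basis index, cost the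
  factor \<open>\<sqrt>n\<close> that separates the trace norm from the Frobenius norm.\<close>

lemma sum_abs_quad_form_le_frobenius:
  assumes v: "orthonormal_basis n v"
  shows "(\<Sum>m<n. \<bar>quad_form n h (v m)\<bar>) \<le> sqrt (real n * (\<Sum>i<n. \<Sum>j<n. (h i j)\<^sup>2))"
proof (rule real_le_rsqrt)
  define y where "y m i = (\<Sum>j<n. v m j * h i j)" for m i
  have qf: "(quad_form n h (v m))\<^sup>2 \<le> (\<Sum>i<n. (y m i)\<^sup>2)" if "m < n" for m
  proof -
    have "quad_form n h (v m) = (\<Sum>i<n. v m i * y m i)"
      by (simp add: quad_form_def y_def sum_distrib_left mult_ac)
    hence "(quad_form n h (v m))\<^sup>2 \<le> (\<Sum>i<n. (v m i)\<^sup>2) * (\<Sum>i<n. (y m i)\<^sup>2)"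
      using Cauchy_Schwarz_ineq_sum[of "v m" "y m" "{..<n}"] by simp
    thus ?thesis using orthonormal_basisD(1)[OF v that that] by (simp add: power2_eq_square)
  qed
  have "(\<Sum>m<n. \<bar>quad_form n h (v m)\<bar>)\<^sup>2 \<le> real n * (\<Sum>m<n. (quad_form n h (v m))\<^sup>2)"
    using Cauchy_Schwarz_ineq_sum[of "\<lambda>_. 1" "\<lambda>m. \<bar>quad_form n h (v m)\<bar>" "{..<n}"] by simp
  also have "\<dots> \<le> real n * (\<Sum>m<n. \<Sum>i<n. (y m i)\<^sup>2)"
    by (intro mult_left_mono sum_mono qf) auto
  also have "(\<Sum>m<n. \<Sum>i<n. (y m i)\<^sup>2) = (\<Sum>i<n. \<Sum>m<n. (y m i)\<^sup>2)" by (rule sum.swap)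
  also have "\<dots> = (\<Sum>i<n. \<Sum>j<n. (h i j)\<^sup>2)" unfolding y_def parseval[OF v] ..
  finally show "(\<Sum>m<n. \<bar>quad_form n h (v m)\<bar>)\<^sup>2 \<le> real n * (\<Sum>i<n. \<Sum>j<n. (h i j)\<^sup>2)" .
qed

text \<open>The matrix with all entries \<open>c\<close> has rank one, which is why its contribution is of order \<open>n\<close> only,
  although its Frobenius norm times \<open>\<sqrt>n\<close> would be of order \<open>n powr (3/2)\<close>.\<close>

lemma sum_abs_quad_form_ones:
  assumes v: "orthonormal_basis n v"
  shows "(\<Sum>m<n. \<bar>quad_form n (\<lambda>_ _. c) (v m)\<bar>) = \<bar>c\<bar> * real n"
proof -
  have "quad_form n (\<lambda>_ _. c) (v m) = c * (\<Sum>i<n. v m i * 1)\<^sup>2" for m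
    by (simp add: quad_form_def power2_eq_square sum_product sum_distrib_left mult_ac)
  hence "(\<Sum>m<n. \<bar>quad_form n (\<lambda>_ _. c) (v m)\<bar>) = \<bar>c\<bar> * (\<Sum>m<n. (\<Sum>i<n. v m i * 1)\<^sup>2)"
    by (simp add: abs_mult sum_distrib_left)
  thus ?thesis unfolding parseval[OF v] by simp
qed

lemma sum_abs_quad_form_identity:
  assumes v: "orthonormal_basis n v"
  shows "(\<Sum>m<n. \<bar>quad_form n (\<lambda>i j. c * of_bool (i = j)) (v m)\<bar>) = \<bar>c\<bar> * real n"
proof -
  have "quad_form n (\<lambda>i j. c * of_bool (i = j)) (v m) = c" if "m < n" for m
  proof -
    have "quad_form n (\<lambda>i j. c * of_bool (i = j)) (v m)
        = (\<Sum>i<n. c * v m i * (\<Sum>j<n. of_bool (i = j) * v m j))"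
      by (simp add: quad_form_def sum_distrib_left mult_ac
          del: sum_mult_of_bool_eq sum_of_bool_mult_eq)
    also have "\<dots> = (\<Sum>i<n. c * (v m i * v m i))"
      by (intro sum.cong refl) (simp add: sum_kronecker_delta del: sum_mult_of_bool_eq sum_of_bool_mult_eq)
    also have "\<dots> = c"
      using orthonormal_basisD(1)[OF v that that] by (simp flip: sum_distrib_left)
    finally show ?thesis .
  qed
  thus ?thesis by simp
qed

text \<open>The shape of the difference is that of centring an adjacency matrix: a constant \<open>c\<close> off the
  diagonal, and an arbitrary fluctuation \<open>h\<close>.\<close>

lemma sum_abs_eigenvalues_perturbation:
  assumes a: "diagonalizes n a l u" and b: "diagonalizes n b l' u'"
    and ab: "\<And>i j. i < n \<Longrightarrow> j < n \<Longrightarrow> a i j = b i j + h i j + (c - c * of_bool (i = j))"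
  shows "\<bar>(\<Sum>k<n. \<bar>l k\<bar>) - (\<Sum>k<n. \<bar>l' k\<bar>)\<bar>
     \<le> sqrt (real n * (\<Sum>i<n. \<Sum>j<n. (h i j)\<^sup>2)) + 2 * \<bar>c\<bar> * real n" (is "_ \<le> ?N")
proof -
  have le: "(\<Sum>m<n. \<bar>quad_form n (\<lambda>i j. a i j - b i j) (v m)\<bar>) \<le> ?N"
    if v: "orthonormal_basis n v" for v
  proof -
    have eq: "quad_form n (\<lambda>i j. a i j - b i j) (v m) = quad_form n h (v m) +
      (quad_form n (\<lambda>_ _. c) (v m) - quad_form n (\<lambda>i j. c * of_bool (i = j)) (v m))" for m
      unfolding quad_form_add[symmetric] quad_form_diff[symmetric]
      by (intro quad_form_cong) (simp add: ab)
    have "(\<Sum>m<n. \<bar>quad_form n (\<lambda>i j. a i j - b i j) (v m)\<bar>)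
       \<le> (\<Sum>m<n. \<bar>quad_form n h (v m)\<bar> + (\<bar>quad_form n (\<lambda>_ _. c) (v m)\<bar>
            + \<bar>quad_form n (\<lambda>i j. c * of_bool (i = j)) (v m)\<bar>))"
      unfolding eq by (intro sum_mono) linarith
    also have "\<dots> \<le> ?N"
      unfolding sum.distrib sum_abs_quad_form_ones[OF v] sum_abs_quad_form_identity[OF v]
      using sum_abs_quad_form_le_frobenius[OF v, of h] by simp
    finally show ?thesis .
  qed
  have "(\<Sum>m<n. \<bar>quad_form n (\<lambda>i j. b i j - a i j) (v m)\<bar>) \<le> ?N" if "orthonormal_basis n v" for v
    using le[OF that] by (simp add: quad_form_diff abs_minus_commute)
  from sum_abs_eigenvalues_le[OF a b le] sum_abs_eigenvalues_le[OF b a this]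
  show ?thesis by linarith
qed

lemma sum_eigenvalues_squared:
  assumes d: "diagonalizes n a l u"
  shows "(\<Sum>k<n. (l k)\<^sup>2) = (\<Sum>i<n. \<Sum>j<n. (a i j)\<^sup>2)"
proof -
  have "(\<Sum>k<n. (l k)\<^sup>2) = (\<Sum>k<n. l k * quad_form n a (u k))"
    using quad_form_eigenvector[OF d] by (simp add: power2_eq_square)
  also have "\<dots> = (\<Sum>k<n. \<Sum>i<n. \<Sum>j<n. a i j * (l k * u k i * u k j))"
    by (simp add: quad_form_def sum_distrib_left mult_ac)
  also have "\<dots> = (\<Sum>i<n. \<Sum>j<n. \<Sum>k<n. a i j * (l k * u k i * u k j))"
    by (rule sum_rotate)
  also have "\<dots> = (\<Sum>i<n. \<Sum>j<n. a i j * a i j)"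
    using d by (intro sum.cong refl) (simp add: diagonalizes_def sum_distrib_left)
  finally show ?thesis by (simp add: power2_eq_square)
qed

section \<open>The sum of the absolute eigenvalues as an integral of the Stieltjes transform\<close>

text \<open>The Stieltjes transform of the empirical eigenvalue distribution, at the point \<open>i t\<close> of the
  imaginary axis.\<close>

definition stieltjes :: "nat \<Rightarrow> (nat \<Rightarrow> real) \<Rightarrow> real \<Rightarrow> complex" where
  "stieltjes n l t = (\<Sum>k<n. 1 / (complex_of_real (l k) - \<i> * complex_of_real t)) / of_nat n"

lemma Im_stieltjes: "Im (stieltjes n l t) = (\<Sum>k<n. t / ((l k)\<^sup>2 + t\<^sup>2)) / real n"
  by (simp add: stieltjes_def Im_divide_of_nat Im_divide power2_eq_square)

lemma one_minus_Im_stieltjes: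
  assumes "n > 0" "t > 0"
  shows "1 - t * Im (stieltjes n l t) = (\<Sum>k<n. (l k)\<^sup>2 / ((l k)\<^sup>2 + t\<^sup>2)) / real n"
proof -
  have "(l k)\<^sup>2 / ((l k)\<^sup>2 + t\<^sup>2) = 1 - t * (t / ((l k)\<^sup>2 + t\<^sup>2))" for k
  proof -
    have "(l k)\<^sup>2 + t\<^sup>2 \<noteq> 0" using assms by (simp add: sum_power2_eq_zero_iff)
    hence "(l k)\<^sup>2 / ((l k)\<^sup>2 + t\<^sup>2) + t\<^sup>2 / ((l k)\<^sup>2 + t\<^sup>2) = 1"
      unfolding add_divide_distrib[symmetric] by (rule divide_self)
    thus ?thesis by (simp add: power2_eq_square)
  qed
  hence "(\<Sum>k<n. (l k)\<^sup>2 / ((l k)\<^sup>2 + t\<^sup>2)) = real n - t * (\<Sum>k<n. t / ((l k)\<^sup>2 + t\<^sup>2))"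
    by (simp add: sum_subtractf sum_distrib_left)
  thus ?thesis using assms by (simp add: Im_stieltjes diff_divide_distrib)
qed

text \<open>The antiderivative is \<open>\<bar>x\<bar> arctan (t / \<bar>x\<bar>)\<close>.\<close>

lemma has_bochner_integral_Coulson:
  fixes x :: real
  shows "has_bochner_integral lborel (\<lambda>t. indicator {0<..} t *\<^sub>R (x\<^sup>2 / (x\<^sup>2 + t\<^sup>2))) (pi / 2 * \<bar>x\<bar>)"
proof -
  let ?f = "\<lambda>t. x\<^sup>2 / (x\<^sup>2 + t\<^sup>2)"
  have nn: "(\<integral>\<^sup>+t. ennreal (?f t) * indicator {0..} t \<partial>lborel) = ennreal (pi / 2 * \<bar>x\<bar>)"
  proof (cases "x = 0")
    case False
    define r where "r = \<bar>x\<bar>"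
    have r: "r > 0" "x\<^sup>2 = r\<^sup>2" using False by (auto simp: r_def)
    have "(\<integral>\<^sup>+t. ennreal (?f t) * indicator {0..} t \<partial>lborel) = pi / 2 * r - r * arctan (0 / r)"
    proof (rule nn_integral_FTC_atLeast)
      show "((\<lambda>t. r * arctan (t / r)) has_real_derivative ?f t) (at t)" for t
      proof -
        have "r\<^sup>2 + t\<^sup>2 > 0" "1 + (t / r)\<^sup>2 > 0" using r by (auto intro: add_pos_nonneg)
        thus ?thesis using r
          by (auto intro!: derivative_eq_intros simp: field_simps power2_eq_square)
      qed
      show "((\<lambda>t. r * arctan (t / r)) \<longlongrightarrow> pi / 2 * r) at_top"
        using r by real_asymp
    qed auto
    thus ?thesis by (simp add: r_def)
  qed simp
  show ?thesis
  proof (rule has_bochner_integral_nn_integral)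
    have "AE t in lborel. t \<noteq> (0::real)" by (rule AE_lborel_singleton)
    hence "AE t in lborel. ennreal (indicator {0<..} t *\<^sub>R ?f t) = ennreal (?f t) * indicator {0..} t"
      by eventually_elim (auto split: split_indicator)
    thus "(\<integral>\<^sup>+t. ennreal (indicator {0<..} t *\<^sub>R ?f t) \<partial>lborel) = ennreal (pi / 2 * \<bar>x\<bar>)"
      unfolding nn[symmetric] by (rule nn_integral_cong_AE)
  qed auto
qed

lemma mean_abs_eq_integral_stieltjes:
  assumes n: "n > 0"
  shows "set_integrable lborel {0<..} (\<lambda>t. 1 - t * Im (stieltjes n l t))"
    and "(\<Sum>k<n. \<bar>l k\<bar>) / real n = 2 / pi * (LBINT t:{0<..}. 1 - t * Im (stieltjes n l t))"
proof -
  have "has_bochner_integral lborel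
      (\<lambda>t. (\<Sum>k<n. indicator {0<..} t *\<^sub>R ((l k)\<^sup>2 / ((l k)\<^sup>2 + t\<^sup>2))) / real n)
      ((\<Sum>k<n. pi / 2 * \<bar>l k\<bar>) / real n)"
    by (intro has_bochner_integral_divide_zero has_bochner_integral_sum has_bochner_integral_Coulson)
  also have "(\<lambda>t. (\<Sum>k<n. indicator {0<..} t *\<^sub>R ((l k)\<^sup>2 / ((l k)\<^sup>2 + t\<^sup>2))) / real n)
      = (\<lambda>t. indicator {0<..} t *\<^sub>R (1 - t * Im (stieltjes n l t)))"
    using n by (auto simp: fun_eq_iff one_minus_Im_stieltjes split: split_indicator)
  also have "(\<Sum>k<n. pi / 2 * \<bar>l k\<bar>) = pi / 2 * (\<Sum>k<n. \<bar>l k\<bar>)"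
    by (rule sum_distrib_left[symmetric])
  finally show "set_integrable lborel {0<..} (\<lambda>t. 1 - t * Im (stieltjes n l t))"
    "(\<Sum>k<n. \<bar>l k\<bar>) / real n = 2 / pi * (LBINT t:{0<..}. 1 - t * Im (stieltjes n l t))"
    by (auto simp: set_integrable_def set_lebesgue_integral_def has_bochner_integral_iff)
qed

text \<open>Each term \<open>x\<^sup>2 / (x\<^sup>2 + t\<^sup>2)\<close> is at most \<open>1\<close> and at most \<open>x\<^sup>2 / t\<^sup>2\<close>, and the \<open>x\<^sup>2\<close> are at most \<open>1\<close> on
  average.  The bound does not depend on \<open>l\<close>, which makes it a dominating function for random
  eigenvalues.\<close>

lemma one_minus_Im_stieltjes_bounds:
  assumes n: "n > 0" and t: "t > 0" and l: "(\<Sum>k<n. (l k)\<^sup>2) \<le> real n"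
  shows "0 \<le> 1 - t * Im (stieltjes n l t)" "1 - t * Im (stieltjes n l t) \<le> 2 / (1 + t\<^sup>2)"
proof -
  have eq: "1 - t * Im (stieltjes n l t) = (\<Sum>k<n. (l k)\<^sup>2 / ((l k)\<^sup>2 + t\<^sup>2)) / real n"
    by (rule one_minus_Im_stieltjes[OF n t])
  show "0 \<le> 1 - t * Im (stieltjes n l t)" unfolding eq by (intro divide_nonneg_nonneg sum_nonneg) auto
  have "(1 + t\<^sup>2) * ((l k)\<^sup>2 / ((l k)\<^sup>2 + t\<^sup>2)) \<le> 1 + (l k)\<^sup>2" for k
  proof -
    have "(l k)\<^sup>2 + t\<^sup>2 > 0" using t by (intro add_nonneg_pos) auto
    hence "(l k)\<^sup>2 / ((l k)\<^sup>2 + t\<^sup>2) \<le> 1" "t\<^sup>2 * ((l k)\<^sup>2 / ((l k)\<^sup>2 + t\<^sup>2)) \<le> (l k)\<^sup>2"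
      by (auto simp: field_simps)
    thus ?thesis unfolding distrib_right by linarith
  qed
  hence "(1 + t\<^sup>2) * (\<Sum>k<n. (l k)\<^sup>2 / ((l k)\<^sup>2 + t\<^sup>2)) \<le> (\<Sum>k<n. 1 + (l k)\<^sup>2)"
    unfolding sum_distrib_left by (intro sum_mono) auto
  also have "\<dots> \<le> 2 * real n" using l by (simp add: sum.distrib)
  finally have "(1 + t\<^sup>2) * (1 - t * Im (stieltjes n l t)) \<le> 2"
    unfolding eq using n by (simp add: field_simps)
  moreover have "1 + t\<^sup>2 > 0" by (intro add_pos_nonneg) auto
  ultimately show "1 - t * Im (stieltjes n l t) \<le> 2 / (1 + t\<^sup>2)" by (simp add: field_simps)
qed

section \<open>Resolvents and rank two changes\<close>

text \<open>The inverse of \<open>a - i t\<close>, written out in a basis that diagonalizes \<open>a\<close>.\<close>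

definition resolvent ::
    "nat \<Rightarrow> (nat \<Rightarrow> real) \<Rightarrow> (nat \<Rightarrow> nat \<Rightarrow> real) \<Rightarrow> real \<Rightarrow> nat \<Rightarrow> nat \<Rightarrow> complex" where
  "resolvent n l u t i j =
     (\<Sum>k<n. complex_of_real (u k i * u k j) / (complex_of_real (l k) - \<i> * complex_of_real t))"

lemma resolvent_sym: "resolvent n l u t i j = resolvent n l u t j i"
  by (simp add: resolvent_def mult.commute)

lemma spectral_denominator_nonzero: "t \<noteq> 0 \<Longrightarrow> complex_of_real x - \<i> * complex_of_real t \<noteq> 0"
  by (simp add: complex_eq_iff)

lemma trace_resolvent:
  assumes u: "orthonormal_basis n u"
  shows "(\<Sum>i<n. resolvent n l u t i i) = of_nat n * stieltjes n l t"
proof -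
  have "(\<Sum>i<n. resolvent n l u t i i) =
      (\<Sum>k<n. complex_of_real (\<Sum>i<n. u k i * u k i) / (complex_of_real (l k) - \<i> * complex_of_real t))"
    unfolding resolvent_def by (subst sum.swap) (simp add: sum_divide_distrib)
  also have "\<dots> = (\<Sum>k<n. 1 / (complex_of_real (l k) - \<i> * complex_of_real t))"
    by (intro sum.cong refl) (simp add: orthonormal_basisD[OF u])
  also have "\<dots> = of_nat n * stieltjes n l t"
    by (cases "n = 0") (simp_all add: stieltjes_def)
  finally show ?thesis .
qed

lemma mult_resolvent:
  assumes d: "diagonalizes n a l u" and t: "t \<noteq> 0" and ik: "i < n" "k < n"
  shows "(\<Sum>j<n. complex_of_real (a i j) * resolvent n l u t j k)
     = of_bool (i = k) + \<i> * t * resolvent n l u t i k"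
proof -
  have u: "orthonormal_basis n u" using d by (simp add: diagonalizes_def)
  define r where "r m = 1 / (complex_of_real (l m) - \<i> * complex_of_real t)" for m
  have res: "resolvent n l u t j k = (\<Sum>m<n. of_real (u m j) * (of_real (u m k) * r m))" for j
    by (simp add: resolvent_def r_def)
  have ev: "(\<Sum>j<n. a i j * u m j) = l m * u m i" if m: "m < n" for m
  proof -
    have "(\<Sum>j<n. a i j * u m j) = (\<Sum>j<n. \<Sum>q<n. (l q * u q i) * (u q j * u m j))"
      using d ik by (intro sum.cong refl) (simp add: diagonalizes_def sum_distrib_left sum_distrib_right mult_ac)
    also have "\<dots> = (\<Sum>q<n. (l q * u q i) * (\<Sum>j<n. u q j * u m j))"
      by (subst sum.swap) (simp add: sum_distrib_left)
    also have "\<dots> = (\<Sum>q<n. (l q * u q i) * of_bool (q = m))"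
      using m by (intro sum.cong refl) (simp add: orthonormal_basisD[OF u])
    also have "\<dots> = l m * u m i" using m by (simp only: sum_kronecker_delta)
    finally show ?thesis .
  qed
  have lr: "l m * r m = 1 + \<i> * t * r m" for m
    using spectral_denominator_nonzero[OF t, of "l m"] by (simp add: r_def field_simps)
  have "(\<Sum>j<n. complex_of_real (a i j) * resolvent n l u t j k)
      = (\<Sum>m<n. complex_of_real (\<Sum>j<n. a i j * u m j) * (of_real (u m k) * r m))"
    unfolding res sum_distrib_left by (subst sum.swap) (simp add: sum_distrib_left sum_distrib_right mult_ac)
  also have "\<dots> = (\<Sum>m<n. of_real (u m i * u m k) * (l m * r m))"
    by (intro sum.cong refl) (simp add: ev)
  also have "\<dots> = complex_of_real (\<Sum>m<n. u m i * u m k) + \<i> * t * resolvent n l u t i k"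
    unfolding lr res by (simp add: algebra_simps sum.distrib sum_distrib_left)
  also have "complex_of_real (\<Sum>m<n. u m i * u m k) = of_bool (i = k)"
    using ik by (simp add: orthonormal_basisD[OF u])
  finally show ?thesis .
qed

text \<open>The eigenvalues of the resolvent have modulus at most \<open>1 / t\<close>, so its rows have norm at most \<open>1 / t\<close>.\<close>

lemma sum_norm_resolvent_squared:
  assumes u: "orthonormal_basis n u" and t: "t > 0" and i: "i < n"
  shows "(\<Sum>j<n. (cmod (resolvent n l u t i j))\<^sup>2) \<le> (1 / t)\<^sup>2"
proof -
  define r where "r m = 1 / (complex_of_real (l m) - \<i> * complex_of_real t)" for m
  have Re: "Re (resolvent n l u t i j) = (\<Sum>k<n. u k j * (u k i * Re (r k)))"
   and Im: "Im (resolvent n l u t i j) = (\<Sum>k<n. u k j * (u k i * Im (r k)))" for j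
  proof -
    have "resolvent n l u t i j = (\<Sum>k<n. of_real (u k j * u k i) * r k)"
      by (simp add: resolvent_def r_def mult_ac)
    thus "Re (resolvent n l u t i j) = (\<Sum>k<n. u k j * (u k i * Re (r k)))"
      "Im (resolvent n l u t i j) = (\<Sum>k<n. u k j * (u k i * Im (r k)))"
      by (simp_all add: mult_ac)
  qed
  have u': "orthonormal_basis n (\<lambda>j k. u k j)" using u by (simp add: orthonormal_basis_def)
  have r: "(cmod (r k))\<^sup>2 \<le> (1 / t)\<^sup>2" for k
  proof -
    have "cmod (complex_of_real (l k) - \<i> * complex_of_real t) \<ge> t"
      using abs_Im_le_cmod[of "complex_of_real (l k) - \<i> * complex_of_real t"] t by simp
    thus ?thesis using t by (intro power_mono) (auto simp: r_def norm_divide field_simps)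
  qed
  have "(\<Sum>j<n. (cmod (resolvent n l u t i j))\<^sup>2) = (\<Sum>k<n. (u k i * Re (r k))\<^sup>2) + (\<Sum>k<n. (u k i * Im (r k))\<^sup>2)"
    unfolding cmod_power2 sum.distrib Re Im parseval[OF u'] ..
  also have "\<dots> = (\<Sum>k<n. (u k i)\<^sup>2 * (cmod (r k))\<^sup>2)"
    unfolding sum.distrib[symmetric]
    by (intro sum.cong refl) (simp add: cmod_power2 power_mult_distrib distrib_left)
  also have "\<dots> \<le> (\<Sum>k<n. (u k i)\<^sup>2 * (1 / t)\<^sup>2)"
    by (intro sum_mono mult_left_mono r) auto
  also have "\<dots> = (1 / t)\<^sup>2"
    unfolding sum_distrib_right[symmetric]
    using orthonormal_basisD(2)[OF u i i] by (simp add: power2_eq_square)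
  finally show ?thesis .
qed

lemma norm_resolvent_le:
  assumes "orthonormal_basis n u" and "t > 0" and "i < n" "j < n"
  shows "cmod (resolvent n l u t i j) \<le> 1 / t"
proof -
  have "(cmod (resolvent n l u t i j))\<^sup>2 \<le> (\<Sum>j<n. (cmod (resolvent n l u t i j))\<^sup>2)"
    using assms by (intro member_le_sum) auto
  also have "\<dots> \<le> (1 / t)\<^sup>2" by (intro sum_norm_resolvent_squared assms)
  finally show ?thesis by (rule power2_le_imp_le) (use \<open>t > 0\<close> in simp)
qed

lemma norm_stieltjes_le:
  assumes t: "t > 0"
  shows "cmod (stieltjes n l t) \<le> 1 / t"
proof -
  have "cmod (1 / (complex_of_real (l k) - \<i> * complex_of_real t)) \<le> 1 / t" for k
    using abs_Im_le_cmod[of "complex_of_real (l k) - \<i> * complex_of_real t"] t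
    by (simp add: norm_divide field_simps)
  hence "cmod (\<Sum>k<n. 1 / (complex_of_real (l k) - \<i> * complex_of_real t)) \<le> (\<Sum>k<n. 1 / t)"
    by (intro sum_norm_le)
  thus ?thesis using t by (cases "n = 0") (auto simp: stieltjes_def norm_divide field_simps)
qed

lemma diagonalizes_sym:
  assumes "diagonalizes n a l u" "i < n" "j < n"
  shows "a i j = a j i"
  using assms by (simp add: diagonalizes_def mult_ac)

lemma resolvent_identity:
  assumes d: "diagonalizes n a l u" and d': "diagonalizes n a' l' u'" and t: "t \<noteq> 0"
    and pq: "p < n" "q < n"
  shows "resolvent n l' u' t p q - resolvent n l u t p q =
    - (\<Sum>i<n. \<Sum>j<n. complex_of_real (a' i j - a i j) * (resolvent n l' u' t p i * resolvent n l u t j q))"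
proof -
  let ?R = "resolvent n l u t" and ?R' = "resolvent n l' u' t"
  have "(\<Sum>i<n. \<Sum>j<n. complex_of_real (a i j) * (?R' p i * ?R j q))
      = (\<Sum>i<n. ?R' p i * (\<Sum>j<n. complex_of_real (a i j) * ?R j q))"
    by (simp add: sum_distrib_left mult_ac)
  also have "\<dots> = (\<Sum>i<n. ?R' p i * (of_bool (i = q) + \<i> * t * ?R i q))"
    by (intro sum.cong refl) (simp add: mult_resolvent[OF d t _ pq(2)])
  also have "\<dots> = (\<Sum>i<n. ?R' p i * of_bool (i = q)) + \<i> * t * (\<Sum>i<n. ?R' p i * ?R i q)"
    unfolding distrib_left sum.distrib sum_distrib_left by (simp only: mult_ac)
  finally have 1: "(\<Sum>i<n. \<Sum>j<n. complex_of_real (a i j) * (?R' p i * ?R j q))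
      = ?R' p q + \<i> * t * (\<Sum>i<n. ?R' p i * ?R i q)"
    by (simp only: sum_kronecker_delta pq)
  have "(\<Sum>i<n. \<Sum>j<n. complex_of_real (a' i j) * (?R' p i * ?R j q))
      = (\<Sum>j<n. ?R j q * (\<Sum>i<n. complex_of_real (a' i j) * ?R' p i))"
    by (subst sum.swap) (simp add: sum_distrib_left mult_ac)
  also have "\<dots> = (\<Sum>j<n. ?R j q * (\<Sum>i<n. complex_of_real (a' j i) * ?R' i p))"
    using diagonalizes_sym[OF d'] resolvent_sym[of n l' u' t]
    by (intro sum.cong refl arg_cong2[of _ _ _ _ "(*)"]) auto
  also have "\<dots> = (\<Sum>j<n. ?R j q * (of_bool (j = p) + \<i> * t * ?R' j p))"
    by (intro sum.cong refl) (simp add: mult_resolvent[OF d' t _ pq(1)])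
  also have "\<dots> = (\<Sum>j<n. ?R j q * of_bool (j = p)) + \<i> * t * (\<Sum>j<n. ?R' p j * ?R j q)"
    unfolding distrib_left sum.distrib sum_distrib_left resolvent_sym[of n l' u' t _ p]
    by (simp only: mult_ac)
  finally have 2: "(\<Sum>i<n. \<Sum>j<n. complex_of_real (a' i j) * (?R' p i * ?R j q))
      = ?R p q + \<i> * t * (\<Sum>i<n. ?R' p i * ?R i q)"
    by (simp only: sum_kronecker_delta pq)
  have "(\<Sum>i<n. \<Sum>j<n. complex_of_real (a' i j - a i j) * (?R' p i * ?R j q))
      = (\<Sum>i<n. \<Sum>j<n. complex_of_real (a' i j) * (?R' p i * ?R j q))
        - (\<Sum>i<n. \<Sum>j<n. complex_of_real (a i j) * (?R' p i * ?R j q))"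
    by (simp only: of_real_diff left_diff_distrib sum_subtractf)
  thus ?thesis unfolding 1 2 by simp
qed

text \<open>The effect on a symmetric matrix of toggling one edge: \<open>a' - a\<close> equals \<open>c\<close> at the two positions of
  the pair and \<open>0\<close> elsewhere.\<close>

definition differ_at_pair ::
    "nat \<Rightarrow> nat \<Rightarrow> nat \<Rightarrow> real \<Rightarrow> (nat \<Rightarrow> nat \<Rightarrow> real) \<Rightarrow> (nat \<Rightarrow> nat \<Rightarrow> real) \<Rightarrow> bool" where
  "differ_at_pair n i j c a a' \<longleftrightarrow> i < n \<and> j < n \<and> i \<noteq> j \<and>
     (\<forall>x<n. \<forall>y<n. a' x y - a x y = (if x = i \<and> y = j \<or> x = j \<and> y = i then c else 0))"

lemma resolvent_differ_at_pair:
  assumes d: "diagonalizes n a l u" and d': "diagonalizes n a' l' u'" and t: "t \<noteq> 0"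
    and ij: "differ_at_pair n i j c a a'" and pq: "p < n" "q < n"
  shows "resolvent n l' u' t p q - resolvent n l u t p q =
    - complex_of_real c * (resolvent n l' u' t p i * resolvent n l u t j q + resolvent n l' u' t p j * resolvent n l u t i q)"
proof -
  let ?f = "\<lambda>x y. resolvent n l' u' t p x * resolvent n l u t y q"
  have i: "i < n" "j < n" "i \<noteq> j" using ij by (auto simp: differ_at_pair_def)
  have "(\<Sum>x<n. \<Sum>y<n. complex_of_real (a' x y - a x y) * ?f x y)
      = (\<Sum>x<n. of_bool (x = i) * (\<Sum>y<n. of_bool (y = j) * (c * ?f x y))
           + of_bool (x = j) * (\<Sum>y<n. of_bool (y = i) * (c * ?f x y)))"
    unfolding sum_distrib_left sum.distrib[symmetric]
    using ij by (intro sum.cong refl) (auto simp: differ_at_pair_def)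
  also have "\<dots> = (\<Sum>x<n. of_bool (x = i) * (c * ?f x j)) + (\<Sum>x<n. of_bool (x = j) * (c * ?f x i))"
    by (simp only: sum_kronecker_delta[OF i(1)] sum_kronecker_delta[OF i(2)] sum.distrib)
  also have "\<dots> = c * (?f i j + ?f j i)"
    by (simp only: sum_kronecker_delta[OF i(1)] sum_kronecker_delta[OF i(2)] distrib_left)
  finally show ?thesis unfolding resolvent_identity[OF d d' t pq] by simp
qed

lemma norm_resolvent_diff_le:
  assumes d: "diagonalizes n a l u" and d': "diagonalizes n a' l' u'" and t: "t > 0" and c: "c \<ge> 0"
    and ij: "differ_at_pair n i j c a a'" and pq: "p < n" "q < n"
  shows "cmod (resolvent n l' u' t p q - resolvent n l u t p q) \<le> 2 * c * (1 / t)\<^sup>2"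
proof -
  have u: "orthonormal_basis n u" "orthonormal_basis n u'"
    using d d' by (auto simp: diagonalizes_def)
  have i: "i < n" "j < n" using ij by (auto simp: differ_at_pair_def)
  have "cmod (resolvent n l' u' t p i * resolvent n l u t j q) \<le> (1 / t) * (1 / t)"
    "cmod (resolvent n l' u' t p j * resolvent n l u t i q) \<le> (1 / t) * (1 / t)"
    unfolding norm_mult using t by (intro mult_mono norm_resolvent_le u pq i; simp)+
  hence "cmod (resolvent n l' u' t p i * resolvent n l u t j q + resolvent n l' u' t p j * resolvent n l u t i q)
      \<le> 2 * (1 / t)\<^sup>2"
    by (intro order_trans[OF norm_triangle_ineq]) (simp add: power2_eq_square)
  hence "c * cmod (resolvent n l' u' t p i * resolvent n l u t j q + resolvent n l' u' t p j * resolvent n l u t i q)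
      \<le> c * (2 * (1 / t)\<^sup>2)" using c by (intro mult_left_mono)
  thus ?thesis using c t ij
    by (simp add: resolvent_differ_at_pair[OF d d' _ ij pq] norm_mult mult_ac)
qed

text \<open>The factor \<open>1 / n\<close> is essential.  It comes from the Cauchy-Schwarz inequality along rows of the two
  resolvents, which bounds the trace of their rank two difference independently of the dimension.\<close>

lemma norm_stieltjes_diff_le:
  assumes d: "diagonalizes n a l u" and d': "diagonalizes n a' l' u'" and t: "t > 0" and c: "c \<ge> 0"
    and ij: "differ_at_pair n i j c a a'"
  shows "cmod (stieltjes n l' t - stieltjes n l t) \<le> 2 * c * (1 / t)\<^sup>2 / real n"
proof -
  let ?R = "resolvent n l u t" and ?R' = "resolvent n l' u' t"
  have u: "orthonormal_basis n u" "orthonormal_basis n u'"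
    using d d' by (auto simp: diagonalizes_def)
  have i: "i < n" "j < n" using ij by (auto simp: differ_at_pair_def)
  have n: "n > 0" using i by simp
  have cs: "cmod (\<Sum>x<n. ?R' x y * ?R z x) \<le> (1 / t)\<^sup>2" if yz: "y < n" "z < n" for y z
  proof -
    have "cmod (\<Sum>x<n. ?R' x y * ?R z x) \<le> (\<Sum>x<n. cmod (?R' y x) * cmod (?R z x))"
      by (rule order_trans[OF norm_sum]) (simp add: norm_mult resolvent_sym[of n l' u' t _ y])
    also have "\<dots> \<le> (1 / t)\<^sup>2"
    proof (rule power2_le_imp_le)
      have "(\<Sum>x<n. cmod (?R' y x) * cmod (?R z x))\<^sup>2
          \<le> (\<Sum>x<n. (cmod (?R' y x))\<^sup>2) * (\<Sum>x<n. (cmod (?R z x))\<^sup>2)"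
        by (rule Cauchy_Schwarz_ineq_sum)
      also have "\<dots> \<le> (1 / t)\<^sup>2 * (1 / t)\<^sup>2"
        by (intro mult_mono sum_norm_resolvent_squared u t yz sum_nonneg) auto
      finally show "(\<Sum>x<n. cmod (?R' y x) * cmod (?R z x))\<^sup>2 \<le> ((1 / t)\<^sup>2)\<^sup>2"
        by (simp add: power2_eq_square[of "(1 / t)\<^sup>2"])
    qed simp
    finally show ?thesis .
  qed
  have "of_nat n * (stieltjes n l' t - stieltjes n l t) = (\<Sum>x<n. ?R' x x - ?R x x)"
    by (simp add: sum_subtractf trace_resolvent u right_diff_distrib)
  also have "\<dots> = (\<Sum>x<n. - complex_of_real c * (?R' x i * ?R j x + ?R' x j * ?R i x))"
    using t by (intro sum.cong refl resolvent_differ_at_pair[OF d d' _ ij]) simp_all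
  also have "\<dots> = - complex_of_real c * ((\<Sum>x<n. ?R' x i * ?R j x) + (\<Sum>x<n. ?R' x j * ?R i x))"
    by (simp only: sum_distrib_left sum.distrib distrib_left)
  finally have eq: "of_nat n * (stieltjes n l' t - stieltjes n l t)
    = - complex_of_real c * ((\<Sum>x<n. ?R' x i * ?R j x) + (\<Sum>x<n. ?R' x j * ?R i x))" .
  have "real n * cmod (stieltjes n l' t - stieltjes n l t)
     = c * cmod ((\<Sum>x<n. ?R' x i * ?R j x) + (\<Sum>x<n. ?R' x j * ?R i x))"
    using arg_cong[OF eq, of cmod]
    by (simp only: norm_mult norm_minus_cancel norm_of_nat norm_of_real abs_of_nonneg[OF c])
  also have "\<dots> \<le> c * ((1 / t)\<^sup>2 + (1 / t)\<^sup>2)"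
    using c i by (intro mult_left_mono order_trans[OF norm_triangle_ineq] add_mono cs)
  finally have "cmod (stieltjes n l' t - stieltjes n l t) * real n \<le> 2 * c * (1 / t)\<^sup>2"
    by (simp add: algebra_simps)
  thus ?thesis using n by (simp only: pos_le_divide_eq of_nat_0_less_iff)
qed

section \<open>Integration by parts over an edge of the random graph\<close>

lemma finite_vertex_pairs: "finite (vertex_pairs n)"
  by (rule finite_subset[of _ "Pow {1..n}"]) (auto simp: vertex_pairs_def)

lemma set_pmf_Gnp: "set_pmf (Gnp n p) \<subseteq> Pow (vertex_pairs n)"
  by (auto simp: Gnp_def)

lemma finite_set_pmf_Gnp: "finite (set_pmf (Gnp n p))"
  by (rule finite_subset[OF set_pmf_Gnp]) (simp add: finite_vertex_pairs)

lemma integrable_Gnp [simp]: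
  fixes F :: "nat set set \<Rightarrow> 'a :: {banach, second_countable_topology}"
  shows "integrable (measure_pmf (Gnp n p)) F"
  by (rule integrable_measure_pmf_finite[OF finite_set_pmf_Gnp])

text \<open>All expectations over random graphs are finite sums, so every function is integrable and none of the
  choices of eigenbases below raises a measurability question.\<close>

abbreviation expec :: "nat \<Rightarrow> real \<Rightarrow> (nat set set \<Rightarrow> 'a) \<Rightarrow> 'a :: {banach, second_countable_topology}" where
  "expec n p F \<equiv> measure_pmf.expectation (Gnp n p) F"

text \<open>Conditioning on the presence of \<open>e\<close>: the remaining edges have a law \<open>N\<close> that is the same in both
  cases.\<close>

lemma expectation_Gnp_split_edge:
  assumes e: "e \<in> vertex_pairs n" and p: "0 \<le> p" "p \<le> 1"
  obtains N :: "nat set set pmf" where "finite (set_pmf N)"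
    "\<And>F :: nat set set \<Rightarrow> 'a :: {banach, second_countable_topology}. expec n p F =
       p *\<^sub>R measure_pmf.expectation N (\<lambda>S. F (insert e S))
       + (1 - p) *\<^sub>R measure_pmf.expectation N (\<lambda>S. F (S - {e}))"
proof -
  let ?V = "vertex_pairs n"
  define V' where "V' = ?V - {e}"
  have V': "finite V'" "e \<notin> V'" "?V = insert e V'" using e finite_vertex_pairs by (auto simp: V'_def)
  define N where "N = map_pmf (\<lambda>f. {x \<in> V'. f x}) (Pi_pmf V' False (\<lambda>_. bernoulli_pmf p))"
  have finN: "finite (set_pmf N)"
    by (rule finite_subset[of _ "Pow V'"]) (auto simp: N_def V')
  have upd: "{x \<in> insert e V'. (f(e := b)) x} = (if b then insert e {x \<in> V'. f x} else {x \<in> V'. f x} - {e})"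
    (is "?A = ?B") for f b
  proof (rule Set.set_eqI)
    show "x \<in> ?A \<longleftrightarrow> x \<in> ?B" for x using V'(2) by (cases "x = e") auto
  qed
  have "Gnp n p = bernoulli_pmf p \<bind> (\<lambda>b. map_pmf (\<lambda>S. if b then insert e S else S - {e}) N)"
    unfolding Gnp_def N_def V'(3) using V'(1,2)
    by (subst Pi_pmf_insert') (simp_all only: map_pmf_def bind_assoc_pmf bind_return_pmf upd simp_thms)
  hence "expec n p F = (\<Sum>b\<in>UNIV. pmf (bernoulli_pmf p) b *\<^sub>R
      measure_pmf.expectation N (\<lambda>S. F (if b then insert e S else S - {e})))"
    for F :: "nat set set \<Rightarrow> 'a"
    using finN by (simp only:) (subst pmf_expectation_bind[where A = UNIV], auto)
  thus thesis using p by (intro that[of N] finN) (simp add: UNIV_bool)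
qed

text \<open>The discrete counterpart of Gaussian integration by parts.  For a Bernoulli variable it holds without
  error term, because a function of one bit is affine.\<close>

theorem expectation_Gnp_by_parts:
  fixes F :: "nat set set \<Rightarrow> 'a :: {banach, second_countable_topology}"
  assumes e: "e \<in> vertex_pairs n" and p: "0 \<le> p" "p \<le> 1"
  shows "expec n p (\<lambda>S. (of_bool (e \<in> S) - p) *\<^sub>R F S)
       = (p * (1 - p)) *\<^sub>R expec n p (\<lambda>S. F (insert e S) - F (S - {e}))"
proof -
  obtain N :: "nat set set pmf" where fin: "finite (set_pmf N)" and N: "\<And>F :: nat set set \<Rightarrow> 'a. expec n p F =
       p *\<^sub>R measure_pmf.expectation N (\<lambda>S. F (insert e S))
       + (1 - p) *\<^sub>R measure_pmf.expectation N (\<lambda>S. F (S - {e}))"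
    using expectation_Gnp_split_edge[OF e p] by blast
  have "expec n p (\<lambda>S. F (insert e S) - F (S - {e})) =
      measure_pmf.expectation N (\<lambda>S. F (insert e S)) - measure_pmf.expectation N (\<lambda>S. F (S - {e}))"
    by (simp add: N integrable_measure_pmf_finite[OF fin] algebra_simps flip: scaleR_add_left)
  moreover have "expec n p (\<lambda>S. (of_bool (e \<in> S) - p) *\<^sub>R F S) =
      (p * (1 - p)) *\<^sub>R (measure_pmf.expectation N (\<lambda>S. F (insert e S))
        - measure_pmf.expectation N (\<lambda>S. F (S - {e})))"
    unfolding N by simp (simp add: algebra_simps)
  ultimately show ?thesis by simp
qed

lemma expec_mono:
  fixes F G :: "nat set set \<Rightarrow> real"
  shows "(\<And>S. S \<in> set_pmf (Gnp n p) \<Longrightarrow> F S \<le> G S) \<Longrightarrow> expec n p F \<le> expec n p G"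
  by (intro integral_mono_AE) (auto simp: AE_measure_pmf_iff)

section \<open>The quadratic equation for the Stieltjes transform\<close>

text \<open>The semicircle law of variance \<open>v\<close> has a Stieltjes transform that solves \<open>1 + z s + v s\<^sup>2 = 0\<close>; this is
  the left-hand side at \<open>z = i t\<close>.\<close>

definition loop_residual :: "real \<Rightarrow> real \<Rightarrow> complex \<Rightarrow> complex" where
  "loop_residual v t s = 1 + \<i> * complex_of_real t * s + complex_of_real v * s\<^sup>2"

lemma norm_loop_residual_le:
  assumes t: "t > 0" and v: "0 \<le> v" "v \<le> 1" and s: "cmod s \<le> 1 / t"
  shows "cmod (loop_residual v t s) \<le> 2 + (1 / t)\<^sup>2"
proof -
  have "cmod (loop_residual v t s) \<le> 1 + t * cmod s + v * (cmod s)\<^sup>2"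
    unfolding loop_residual_def using t v
    by (intro order_trans[OF norm_triangle_ineq] add_mono) (auto simp: norm_mult norm_power)
  also have "\<dots> \<le> 1 + t * (1 / t) + 1 * (1 / t)\<^sup>2"
    using t v s by (intro add_mono mult_mono power_mono) auto
  finally show ?thesis using t by simp
qed

lemma norm_loop_residual_diff_le:
  assumes t: "t > 0" and v: "0 \<le> v" "v \<le> 1" and s: "cmod s \<le> 1 / t" "cmod s' \<le> 1 / t"
  shows "cmod (loop_residual v t s' - loop_residual v t s) \<le> (t + 2 * (1 / t)) * cmod (s' - s)"
proof -
  have "loop_residual v t s' - loop_residual v t s = (\<i> * t + v * (s' + s)) * (s' - s)"
    by (simp add: loop_residual_def power2_eq_square algebra_simps)
  moreover have "cmod (\<i> * t + v * (s' + s)) \<le> t + 2 * (1 / t)"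
  proof -
    have "cmod (s' + s) \<le> 2 * (1 / t)" using norm_triangle_ineq[of s' s] s by linarith
    hence "v * cmod (s' + s) \<le> 1 * (2 * (1 / t))" using v by (intro mult_mono) auto
    thus ?thesis using t v norm_triangle_ineq[of "\<i> * t" "v * (s' + s)"] by (simp add: norm_mult)
  qed
  ultimately show ?thesis by (simp add: norm_mult mult_right_mono)
qed

text \<open>Here \<open>P\<close> and \<open>M\<close> stand for the resolvents with and without the edge, \<open>R\<close> for the resolvent of the
  given graph (which is one of the two), and \<open>qp\<close>, \<open>qm\<close>, \<open>q\<close> for a bounded factor evaluated at the same
  three graphs.  The leading term of the discrete derivative of \<open>R j i * q\<close> is the product of the diagonal
  entries.  In the error, \<open>(R j i)\<^sup>2\<close> is kept because it is small only after summation over a row.\<close>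

lemma edge_derivative_estimate:
  fixes P M R :: "nat \<Rightarrow> nat \<Rightarrow> complex" and qp qm q :: complex
  assumes c: "c \<ge> 0" and K: "K \<ge> 0"
    and exact: "P j i - M j i = - complex_of_real c * (P j i * M j i + P j j * M i i)"
    and bd: "\<And>x y. x \<in> {i,j} \<Longrightarrow> y \<in> {i,j} \<Longrightarrow> cmod (P x y) \<le> K \<and> cmod (M x y) \<le> K \<and>
        cmod (P x y - M x y) \<le> 2 * c * K\<^sup>2"
    and q: "cmod qp \<le> B" "cmod qm \<le> B" "cmod (qp - qm) \<le> E"
    and R: "(R, q) = (P, qp) \<or> (R, q) = (M, qm)"
  shows "cmod (P j i * qp - M j i * qm + c * (R i i * R j j * q))
     \<le> c * B * (cmod (R j i))\<^sup>2 + 4 * c\<^sup>2 * B * K ^ 3 + (c * K\<^sup>2 + K) * E"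
proof -
  have B: "B \<ge> 0" using q(1) norm_ge_zero order_trans by blast
  have E: "E \<ge> 0" using q(3) norm_ge_zero order_trans by blast
  have 1: "cmod (P j i * M j i) \<le> (cmod (R j i))\<^sup>2 + 2 * c * K ^ 3"
  proof -
    obtain D where D: "P j i * M j i = (R j i)\<^sup>2 + R j i * D" "cmod D \<le> 2 * c * K\<^sup>2"
    proof -
      have "cmod (P j i - M j i) \<le> 2 * c * K\<^sup>2" "cmod (M j i - P j i) \<le> 2 * c * K\<^sup>2"
        using bd[of j i] by (auto simp: norm_minus_commute)
      moreover have "P j i * M j i = (P j i)\<^sup>2 + P j i * (M j i - P j i)"
        "P j i * M j i = (M j i)\<^sup>2 + M j i * (P j i - M j i)"
        by (simp_all add: power2_eq_square algebra_simps)
      ultimately show thesis using that R by blast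
    qed
    have Rji: "cmod (R j i) \<le> K" using R bd[of j i] by auto
    have "cmod (P j i * M j i) \<le> (cmod (R j i))\<^sup>2 + cmod (R j i) * cmod D"
      unfolding D(1) by (intro order_trans[OF norm_triangle_ineq]) (simp add: norm_mult norm_power)
    also have "cmod (R j i) * cmod D \<le> K * (2 * c * K\<^sup>2)"
      using Rji D(2) K by (intro mult_mono) auto
    finally show ?thesis by (simp add: power2_eq_square power3_eq_cube mult_ac)
  qed
  have 2: "cmod (P j j * M i i * qp - R i i * R j j * q) \<le> 2 * c * K ^ 3 * B + K\<^sup>2 * E"
  proof -
    have small: "cmod (w * x * y) \<le> 2 * c * K ^ 3 * B" if "cmod w \<le> K" "cmod x \<le> 2 * c * K\<^sup>2" "cmod y \<le> B"
      for w x y :: complex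
    proof -
      have "cmod (w * x * y) \<le> K * (2 * c * K\<^sup>2) * B"
        unfolding norm_mult using that K B c by (intro mult_mono) auto
      thus ?thesis by (simp add: power2_eq_square power3_eq_cube mult_ac)
    qed
    from R show ?thesis
    proof
      assume "(R, q) = (P, qp)"
      hence "P j j * M i i * qp - R i i * R j j * q = P j j * (M i i - P i i) * qp"
        by (simp add: algebra_simps)
      moreover have "cmod (P j j * (M i i - P i i) * qp) \<le> 2 * c * K ^ 3 * B"
        using bd[of j j] bd[of i i] q by (intro small) (auto simp: norm_minus_commute)
      moreover have "0 \<le> K\<^sup>2 * E" using E by simp
      ultimately show ?thesis by simp
    next
      assume "(R, q) = (M, qm)"
      hence "P j j * M i i * qp - R i i * R j j * q
          = M i i * (P j j - M j j) * qp + M i i * M j j * (qp - qm)"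
        by (simp add: algebra_simps)
      moreover have "cmod (M i i * (P j j - M j j) * qp) \<le> 2 * c * K ^ 3 * B"
        using bd[of j j] bd[of i i] q by (intro small) auto
      moreover have "cmod (M i i * M j j * (qp - qm)) \<le> K\<^sup>2 * E"
        unfolding norm_mult power2_eq_square using bd[of j j] bd[of i i] q K by (intro mult_mono) auto
      ultimately show ?thesis using norm_triangle_mono by metis
    qed
  qed
  have 3: "cmod (M j i * (qp - qm)) \<le> K * E"
    unfolding norm_mult using bd[of j i] q K by (intro mult_mono) auto
  have "P j i * qp - M j i * qm + c * (R i i * R j j * q)
      = (P j i - M j i) * qp + M j i * (qp - qm) + c * (R i i * R j j * q)"
    by (simp add: algebra_simps)
  also have "\<dots> = - (c * ((P j i * M j i) * qp)) - c * (P j j * M i i * qp - R i i * R j j * q)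
        + M j i * (qp - qm)"
    unfolding exact by (simp add: algebra_simps)
  finally have "cmod (P j i * qp - M j i * qm + c * (R i i * R j j * q))
      \<le> c * (cmod (P j i * M j i) * cmod qp) + c * cmod (P j j * M i i * qp - R i i * R j j * q)
        + cmod (M j i * (qp - qm))"
    using c by (auto intro!: order_trans[OF norm_triangle_ineq] order_trans[OF norm_triangle_ineq4]
        add_mono simp: norm_mult)
  also have "\<dots> \<le> c * (((cmod (R j i))\<^sup>2 + 2 * c * K ^ 3) * B) + c * (2 * c * K ^ 3 * B + K\<^sup>2 * E) + K * E"
    using c 1 2 3 q(1) B K by (intro add_mono mult_left_mono mult_mono) auto
  finally show ?thesis by (simp add: algebra_simps power2_eq_square)
qed

text \<open>The normalization by \<open>\<sqrt>n\<close> keeps the mean squared eigenvalue bounded.  As in the Lanzhou matrix, index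
  \<open>i\<close> belongs to the vertex \<open>Suc i\<close>.\<close>

definition wigner :: "nat \<Rightarrow> real \<Rightarrow> nat set set \<Rightarrow> nat \<Rightarrow> nat \<Rightarrow> real" where
  "wigner n p S i j = (if i = j then 0 else (of_bool ({Suc i, Suc j} \<in> S) - p) / sqrt (real n))"

lemma wigner_sym: "wigner n p S i j = wigner n p S j i"
  by (simp add: wigner_def insert_commute)

lemma edge_in_vertex_pairs: "i < n \<Longrightarrow> j < n \<Longrightarrow> i \<noteq> j \<Longrightarrow> {Suc i, Suc j} \<in> vertex_pairs n"
  by (auto simp: vertex_pairs_def)

lemma differ_at_pair_wigner:
  assumes "i < n" "j < n" "i \<noteq> j"
  shows "differ_at_pair n i j (1 / sqrt (real n))
     (wigner n p (S - {{Suc i, Suc j}})) (wigner n p (insert {Suc i, Suc j} S))"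
  using assms unfolding differ_at_pair_def wigner_def
  by (auto simp: doubleton_eq_iff diff_divide_distrib)

text \<open>The factor \<open>q\<close> is the conjugate of the residual itself; it depends on the graph only through the
  Stieltjes transform, so toggling an edge changes it by \<open>O(c / n)\<close>.\<close>

lemma wigner_edge_derivative:
  assumes n: "i < n" "j < n" "i \<noteq> j" and t: "t > 0" and v: "0 \<le> v" "v \<le> 1"
    and d: "\<And>S. diagonalizes n (wigner n p S) (l S) (u S)"
  defines "R \<equiv> \<lambda>S. resolvent n (l S) (u S) t"
    and "q \<equiv> \<lambda>S. cnj (loop_residual v t (stieltjes n (l S) t))"
    and "c \<equiv> 1 / sqrt (real n)" and "K \<equiv> 1 / t" and "B \<equiv> 2 + (1 / t)\<^sup>2" and "e \<equiv> {Suc i, Suc j}"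
  shows "cmod (R (insert e S) j i * q (insert e S) - R (S - {e}) j i * q (S - {e})
            + c * (R S i i * R S j j * q S))
     \<le> c * B * (cmod (R S j i))\<^sup>2 + 4 * c\<^sup>2 * B * K ^ 3
        + (c * K\<^sup>2 + K) * ((t + 2 * K) * (2 * c * K\<^sup>2 / real n))"
proof (rule edge_derivative_estimate)
  let ?P = "insert e S" and ?M = "S - {e}"
  have dif: "differ_at_pair n i j c (wigner n p ?M) (wigner n p ?P)"
    unfolding c_def e_def by (rule differ_at_pair_wigner[OF n])
  have u: "orthonormal_basis n (u T)" for T using d by (simp add: diagonalizes_def)
  show c: "c \<ge> 0" by (simp add: c_def)
  show "K \<ge> 0" using t by (simp add: K_def)
  show "R ?P j i - R ?M j i = - complex_of_real c * (R ?P j i * R ?M j i + R ?P j j * R ?M i i)"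
    unfolding R_def using t by (intro resolvent_differ_at_pair[OF d d _ dif]) (simp_all add: n)
  show "cmod (R ?P x y) \<le> K \<and> cmod (R ?M x y) \<le> K \<and> cmod (R ?P x y - R ?M x y) \<le> 2 * c * K\<^sup>2"
    if "x \<in> {i,j}" "y \<in> {i,j}" for x y
  proof -
    have "x < n" "y < n" using that n by auto
    thus ?thesis unfolding R_def K_def
      by (intro conjI norm_resolvent_le u t norm_resolvent_diff_le[OF d d t c dif])
  qed
  show "cmod (q ?P) \<le> B" "cmod (q ?M) \<le> B"
    unfolding q_def complex_mod_cnj B_def by (intro norm_loop_residual_le norm_stieltjes_le t v)+
  have "cmod (q ?P - q ?M) = cmod (loop_residual v t (stieltjes n (l ?P) t) - loop_residual v t (stieltjes n (l ?M) t))"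
    unfolding q_def complex_cnj_diff[symmetric] by (rule complex_mod_cnj)
  also have "\<dots> \<le> (t + 2 * K) * cmod (stieltjes n (l ?P) t - stieltjes n (l ?M) t)"
    unfolding K_def by (intro norm_loop_residual_diff_le norm_stieltjes_le t v)
  also have "\<dots> \<le> (t + 2 * K) * (2 * c * K\<^sup>2 / real n)"
    unfolding K_def using t
    by (intro mult_left_mono norm_stieltjes_diff_le[OF d d t c dif]) auto
  finally show "cmod (q ?P - q ?M) \<le> (t + 2 * K) * (2 * c * K\<^sup>2 / real n)" .
  show "(R S, q S) = (R ?P, q ?P) \<or> (R S, q S) = (R ?M, q ?M)"
    by (cases "e \<in> S") (simp_all add: insert_absorb)
qed

lemma norm_expec_le:
  fixes F :: "nat set set \<Rightarrow> complex"
  assumes "\<And>S. cmod (F S) \<le> G S"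
  shows "cmod (expec n p F) \<le> expec n p G"
  using integral_norm_bound[of "measure_pmf (Gnp n p)" F] assms
  by (meson expec_mono order_trans)

text \<open>The second moment of the residual \<open>Q\<close> is \<open>E (1 + i t s) cnj Q + v E s\<^sup>2 cnj Q\<close>.  Written as double sums over
  matrix indices, the two terms cancel to leading order by integration by parts, off the diagonal pair
  by pair; the diagonal contributes only \<open>O(1 / n)\<close>.\<close>

theorem expectation_loop_residual:
  assumes p: "0 \<le> p" "p \<le> 1" and t: "t > 0" and n: "n > 0"
    and d: "\<And>S. diagonalizes n (wigner n p S) (l S) (u S)"
  defines "K \<equiv> 1 / t" and "B \<equiv> 2 + (1 / t)\<^sup>2"
  shows "expec n p (\<lambda>S. (cmod (loop_residual (p * (1 - p)) t (stieltjes n (l S) t)))\<^sup>2)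
    \<le> (2 * B * K\<^sup>2 + 4 * B * K ^ 3 + 2 * K\<^sup>2 * (K\<^sup>2 + K) * (t + 2 * K)) / sqrt (real n)"
proof -
  define v where "v = p * (1 - p)"
  have v: "0 \<le> v" "v \<le> 1" using p mult_mono[of p 1 "1 - p" 1] by (auto simp: v_def)
  define c where "c = 1 / sqrt (real n)"
  have c: "0 \<le> c" "c \<le> 1" and c2: "c * c = 1 / real n" and c2': "c\<^sup>2 = 1 / real n"
    using n by (auto simp: c_def power_divide)
  have K: "K \<ge> 0" and B: "B \<ge> 0" using t by (auto simp: K_def B_def)
  define R where "R = (\<lambda>S. resolvent n (l S) (u S) t)"
  define s where "s = (\<lambda>S. stieltjes n (l S) t)"
  define Q where "Q = (\<lambda>S. loop_residual v t (s S))"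
  define X where "X = wigner n p"
  have u: "orthonormal_basis n (u T)" for T using d by (simp add: diagonalizes_def)
  have QB: "cmod (Q S) \<le> B" for S
    unfolding Q_def B_def s_def by (intro norm_loop_residual_le norm_stieltjes_le t v)
  have RK: "cmod (R S i j) \<le> K" if "i < n" "j < n" for S i j
    unfolding R_def K_def by (intro norm_resolvent_le u t that)
  \<comment> \<open>The summand \<open>T i j\<close> pairs the contribution of \<open>X\<^sub>i\<^sub>j R\<^sub>j\<^sub>i\<close> with that of \<open>R\<^sub>i\<^sub>i R\<^sub>j\<^sub>j\<close> which cancels it.\<close>
  define T where "T = (\<lambda>i j S. complex_of_real (X S i j) * (R S j i * cnj (Q S))
      + complex_of_real (v / n) * (R S i i * R S j j * cnj (Q S)))"
  define E where "E = (t + 2 * K) * (2 * c * K\<^sup>2 / real n)"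
  have expand: "complex_of_real ((cmod (Q S))\<^sup>2) = (\<Sum>i<n. \<Sum>j<n. T i j S) / of_nat n" for S
  proof -
    have tr: "(\<Sum>i<n. R S i i) = of_nat n * s S"
      unfolding R_def s_def by (rule trace_resolvent[OF u])
    have XR: "(\<Sum>i<n. \<Sum>j<n. complex_of_real (X S i j) * R S j i) = of_nat n * (1 + \<i> * t * s S)"
    proof -
      have "(\<Sum>i<n. \<Sum>j<n. complex_of_real (X S i j) * R S j i) = (\<Sum>i<n. 1 + \<i> * t * R S i i)"
        unfolding R_def X_def using t by (intro sum.cong refl) (simp add: mult_resolvent[OF d])
      also have "\<dots> = of_nat n * (1 + \<i> * t * s S)"
        unfolding sum.distrib sum_distrib_left[symmetric] tr by (simp add: algebra_simps)
      finally show ?thesis .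
    qed
    have RR: "(\<Sum>i<n. \<Sum>j<n. R S i i * R S j j) = (of_nat n * s S)\<^sup>2"
      unfolding power2_eq_square sum_product[symmetric] tr ..
    have "(\<Sum>i<n. \<Sum>j<n. T i j S) = (\<Sum>i<n. \<Sum>j<n. complex_of_real (X S i j) * R S j i) * cnj (Q S)
        + complex_of_real (v / n) * (\<Sum>i<n. \<Sum>j<n. R S i i * R S j j) * cnj (Q S)"
      unfolding T_def sum.distrib sum_distrib_left sum_distrib_right by (simp only: mult_ac)
    also have "\<dots> = of_nat n * (Q S * cnj (Q S))"
      unfolding XR RR using n
      by (simp add: Q_def loop_residual_def power2_eq_square field_simps)
    also have "Q S * cnj (Q S) = complex_of_real ((cmod (Q S))\<^sup>2)"
      by (metis complex_norm_square)
    finally show ?thesis using n by simp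
  qed
  have off_diag: "cmod (expec n p (T i j)) \<le> c\<^sup>2 * B * expec n p (\<lambda>S. (cmod (R S j i))\<^sup>2)
       + (4 * c ^ 3 * B * K ^ 3 + c * ((c * K\<^sup>2 + K) * E))" if ij: "i < n" "j < n" "i \<noteq> j" for i j
  proof -
    define e where "e = {Suc i, Suc j}"
    define F where "F = (\<lambda>S. R S j i * cnj (Q S))"
    define H where "H = (\<lambda>S. F (insert e S) - F (S - {e}) + complex_of_real c * (R S i i * R S j j * cnj (Q S)))"
    have H: "cmod (H S) \<le> c * B * (cmod (R S j i))\<^sup>2 + (4 * c\<^sup>2 * B * K ^ 3 + (c * K\<^sup>2 + K) * E)" for S
      using wigner_edge_derivative[OF ij t v d, of S]
      unfolding H_def F_def R_def Q_def s_def c_def K_def B_def E_def e_def by (simp only: add.assoc)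
    have "(\<lambda>S. complex_of_real (X S i j) * F S) = (\<lambda>S. c *\<^sub>R ((of_bool (e \<in> S) - p) *\<^sub>R F S))"
      using ij by (simp add: fun_eq_iff X_def wigner_def c_def e_def scaleR_conv_of_real)
    hence "expec n p (\<lambda>S. complex_of_real (X S i j) * F S)
        = c *\<^sub>R expec n p (\<lambda>S. (of_bool (e \<in> S) - p) *\<^sub>R F S)"
      by (simp only: integral_scaleR_right)
    also have "\<dots> = c *\<^sub>R (v *\<^sub>R expec n p (\<lambda>S. F (insert e S) - F (S - {e})))"
      unfolding e_def v_def expectation_Gnp_by_parts[OF edge_in_vertex_pairs[OF ij] p] ..
    finally have "expec n p (\<lambda>S. complex_of_real (X S i j) * F S)
        = c *\<^sub>R (v *\<^sub>R expec n p (\<lambda>S. F (insert e S) - F (S - {e})))" .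
    moreover have "complex_of_real (v / n) = complex_of_real (c * v) * complex_of_real c"
      using c2 by (metis mult.commute mult.left_commute of_real_mult times_divide_eq_right mult.right_neutral)
    ultimately have "expec n p (T i j) = complex_of_real (c * v) * expec n p H"
      unfolding T_def H_def F_def
      by (simp add: scaleR_conv_of_real algebra_simps del: of_real_divide)
    hence "cmod (expec n p (T i j)) = c * v * cmod (expec n p H)"
      using c v by (simp add: norm_mult)
    also have "\<dots> \<le> c * 1 * expec n p (\<lambda>S. c * B * (cmod (R S j i))\<^sup>2
        + (4 * c\<^sup>2 * B * K ^ 3 + (c * K\<^sup>2 + K) * E))"
      using c v by (intro mult_mono norm_expec_le H) auto
    also have "expec n p (\<lambda>S. c * B * (cmod (R S j i))\<^sup>2 + (4 * c\<^sup>2 * B * K ^ 3 + (c * K\<^sup>2 + K) * E))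
        = c * B * expec n p (\<lambda>S. (cmod (R S j i))\<^sup>2) + (4 * c\<^sup>2 * B * K ^ 3 + (c * K\<^sup>2 + K) * E)"
      by simp
    finally show ?thesis
      by (simp add: algebra_simps power2_eq_square power3_eq_cube)
  qed
  have diag: "cmod (expec n p (T i i)) \<le> c\<^sup>2 * (K\<^sup>2 * B)" if i: "i < n" for i
  proof -
    have "cmod (T i i S) \<le> c\<^sup>2 * (K\<^sup>2 * B)" for S
    proof -
      have "cmod (T i i S) = v * c\<^sup>2 * (cmod (R S i i) * cmod (R S i i) * cmod (Q S))"
        using v by (simp add: T_def X_def wigner_def norm_mult c2' norm_divide)
      also have "\<dots> \<le> 1 * c\<^sup>2 * (K * K * B)"
        using v c K B RK[OF i i] QB by (intro mult_mono mult_nonneg_nonneg) auto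
      finally show ?thesis by (simp add: power2_eq_square)
    qed
    thus ?thesis using norm_expec_le[of "T i i" "\<lambda>_. c\<^sup>2 * (K\<^sup>2 * B)" n p] by simp
  qed
  define W where "W = 4 * c ^ 3 * B * K ^ 3 + c * ((c * K\<^sup>2 + K) * E)"
  have E: "E \<ge> 0" using t K c by (simp add: E_def)
  have W: "W \<ge> 0" unfolding W_def using c B K E by simp
  have all: "cmod (expec n p (T i j)) \<le> (c\<^sup>2 * B * expec n p (\<lambda>S. (cmod (R S j i))\<^sup>2) + W)
      + c\<^sup>2 * (K\<^sup>2 * B) * of_bool (i = j)" if "i < n" "j < n" for i j
  proof (cases "i = j")
    case True
    have "0 \<le> expec n p (\<lambda>S. (cmod (R S j i))\<^sup>2)" by (rule Bochner_Integration.integral_nonneg) auto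
    hence "0 \<le> c\<^sup>2 * B * expec n p (\<lambda>S. (cmod (R S j i))\<^sup>2)" using B by simp
    thus ?thesis using diag[OF that(1)] W True by simp
  qed (use off_diag[OF that] in \<open>simp add: W_def\<close>)
  have rows: "(\<Sum>i<n. expec n p (\<lambda>S. (cmod (R S j i))\<^sup>2)) \<le> K\<^sup>2" if j: "j < n" for j
  proof -
    have "(\<Sum>i<n. expec n p (\<lambda>S. (cmod (R S j i))\<^sup>2)) = expec n p (\<lambda>S. \<Sum>i<n. (cmod (R S j i))\<^sup>2)"
      by (simp add: integral_sum)
    also have "\<dots> \<le> expec n p (\<lambda>_. K\<^sup>2)"
      unfolding R_def K_def by (intro expec_mono sum_norm_resolvent_squared u t j)
    finally show ?thesis by simp
  qed
  have "complex_of_real (expec n p (\<lambda>S. (cmod (Q S))\<^sup>2)) = expec n p (\<lambda>S. complex_of_real ((cmod (Q S))\<^sup>2))"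
    by (rule integral_complex_of_real[symmetric])
  also have "\<dots> = (\<Sum>i<n. \<Sum>j<n. expec n p (T i j)) / of_nat n"
    unfolding expand by (simp add: integral_sum)
  finally have "expec n p (\<lambda>S. (cmod (Q S))\<^sup>2) = cmod (\<Sum>i<n. \<Sum>j<n. expec n p (T i j)) / real n"
  proof -
    assume eq: "complex_of_real (expec n p (\<lambda>S. (cmod (Q S))\<^sup>2)) = (\<Sum>i<n. \<Sum>j<n. expec n p (T i j)) / of_nat n"
    have "0 \<le> expec n p (\<lambda>S. (cmod (Q S))\<^sup>2)" by (rule Bochner_Integration.integral_nonneg) auto
    thus ?thesis using arg_cong[OF eq, of cmod] by (simp only: norm_divide norm_of_real norm_of_nat abs_of_nonneg)
  qed
  also have "\<dots> \<le> (\<Sum>i<n. \<Sum>j<n. (c\<^sup>2 * B * expec n p (\<lambda>S. (cmod (R S j i))\<^sup>2) + W)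
      + c\<^sup>2 * (K\<^sup>2 * B) * of_bool (i = j)) / real n"
    by (intro divide_right_mono order_trans[OF norm_sum] sum_mono all) auto
  also have "(\<Sum>i<n. \<Sum>j<n. (c\<^sup>2 * B * expec n p (\<lambda>S. (cmod (R S j i))\<^sup>2) + W)
      + c\<^sup>2 * (K\<^sup>2 * B) * of_bool (i = j))
      = c\<^sup>2 * B * (\<Sum>j<n. \<Sum>i<n. expec n p (\<lambda>S. (cmod (R S j i))\<^sup>2)) + real n * (real n * W)
        + c\<^sup>2 * (K\<^sup>2 * B) * (\<Sum>i<n. \<Sum>j<n. of_bool (i = j))"
    by (subst (2) sum.swap) (simp only: sum.distrib sum_distrib_left sum_constant card_lessThan)
  also have "(\<Sum>i<n. \<Sum>j<n. of_bool (i = j)) = real n"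
    using sum_kronecker_delta[of _ n "\<lambda>_. 1::real"] by simp
  also have "(c\<^sup>2 * B * (\<Sum>j<n. \<Sum>i<n. expec n p (\<lambda>S. (cmod (R S j i))\<^sup>2)) + real n * (real n * W)
        + c\<^sup>2 * (K\<^sup>2 * B) * real n) / real n
      \<le> (c\<^sup>2 * B * (\<Sum>j<n. K\<^sup>2) + real n * (real n * W) + c\<^sup>2 * (K\<^sup>2 * B) * real n) / real n"
    using B by (intro divide_right_mono add_mono mult_left_mono sum_mono rows) auto
  also have "\<dots> = 2 * B * K\<^sup>2 * c\<^sup>2 + real n * W"
    using n by (simp add: field_simps)
  also have "real n * W = 4 * c * B * K ^ 3 + 2 * K\<^sup>2 * (c * K\<^sup>2 + K) * (t + 2 * K) * c\<^sup>2"
  proof -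
    have nc: "real n * c\<^sup>2 = 1" using n by (simp add: c2')
    have "real n * W = 4 * c * B * K ^ 3 * (real n * c\<^sup>2) + c * (c * K\<^sup>2 + K) * (real n * E)"
      by (simp add: W_def power2_eq_square power3_eq_cube algebra_simps)
    also have "real n * E = (t + 2 * K) * (2 * c * K\<^sup>2)" using n by (simp add: E_def)
    finally show ?thesis unfolding nc by (simp add: power2_eq_square algebra_simps)
  qed
  also have "2 * B * K\<^sup>2 * c\<^sup>2 + (4 * c * B * K ^ 3 + 2 * K\<^sup>2 * (c * K\<^sup>2 + K) * (t + 2 * K) * c\<^sup>2)
     \<le> 2 * B * K\<^sup>2 * c + (4 * c * B * K ^ 3 + 2 * K\<^sup>2 * (1 * K\<^sup>2 + K) * (t + 2 * K) * c)"
  proof -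
    have "c\<^sup>2 \<le> c" using c mult_mono[of c 1 c c] by (simp add: power2_eq_square)
    thus ?thesis using c B K t
      by (intro add_mono mult_mono mult_left_mono order_refl) auto
  qed
  finally show ?thesis by (simp add: Q_def s_def v_def c_def add_divide_distrib)
qed

section \<open>The semicircle limit\<close>

text \<open>On the imaginary axis the Stieltjes transform of the semicircle law of variance \<open>v\<close> is purely imaginary;
  this is its imaginary part at \<open>i t\<close>.\<close>

definition semicircle_transform :: "real \<Rightarrow> real \<Rightarrow> real" where
  "semicircle_transform v t = (sqrt (t\<^sup>2 + 4 * v) - t) / (2 * v)"

lemma one_minus_semicircle_transform:
  assumes v: "v > 0"
  shows "1 - t * semicircle_transform v t = (sqrt (t\<^sup>2 + 4 * v) - t)\<^sup>2 / (4 * v)"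
proof -
  have "(sqrt (t\<^sup>2 + 4 * v))\<^sup>2 = t\<^sup>2 + 4 * v" using v by simp
  thus ?thesis using v
    by (simp add: semicircle_transform_def field_simps power2_eq_square)
qed

text \<open>The residual factors as \<open>v (s - i m) (s - i m')\<close> with \<open>m > 0 > m'\<close>.  In the closed upper half plane the
  distance from \<open>s\<close> to the lower root \<open>i m'\<close> is at least \<open>- m'\<close>, and \<open>- v m' \<ge> t\<close>.\<close>

lemma semicircle_transform_stability:
  assumes v: "v > 0" and t: "t > 0" and s: "Im s \<ge> 0"
  shows "t * cmod (s - \<i> * semicircle_transform v t) \<le> cmod (loop_residual v t s)"
proof -
  define r where "r = sqrt (t\<^sup>2 + 4 * v)"
  have r2: "r\<^sup>2 = t\<^sup>2 + 4 * v" using v by (simp add: r_def)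
  have rt: "r \<ge> t" unfolding r_def using v by (intro real_le_rsqrt) simp
  define m where "m = semicircle_transform v t"
  define m' where "m' = - (r + t) / (2 * v)"
  have m: "m = (r - t) / (2 * v)" by (simp add: m_def semicircle_transform_def r_def)
  have sum: "v * (m + m') = - t" and prod: "v * (m * m') = - 1"
  proof -
    show "v * (m + m') = - t"
      using v by (simp add: m m'_def field_simps)
    have "v * (m * m') = - (r\<^sup>2 - t\<^sup>2) / (4 * v)"
      using v by (simp add: m m'_def field_simps power2_eq_square)
    thus "v * (m * m') = - 1" using v by (simp add: r2)
  qed
  have "loop_residual v t s = of_real v * (s - \<i> * m) * (s - \<i> * m')"
  proof -
    have "of_real v * (s - \<i> * m) * (s - \<i> * m')
        = of_real v * s\<^sup>2 - \<i> * complex_of_real (v * (m + m')) * s - complex_of_real (v * (m * m'))"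
      by (simp add: algebra_simps power2_eq_square)
    thus ?thesis unfolding sum prod by (simp add: loop_residual_def)
  qed
  hence eq: "cmod (loop_residual v t s) = (v * cmod (s - \<i> * m')) * cmod (s - \<i> * m)"
    using v by (simp add: norm_mult)
  have "t \<le> v * (Im s - m')"
  proof -
    have "v * (Im s - m') = v * Im s + (r + t) / 2" using v by (simp add: m'_def field_simps)
    moreover have "0 \<le> v * Im s" using v s by simp
    hence "t \<le> v * Im s + (r + t) / 2" using rt by (intro add_increasing) simp_all
    ultimately show ?thesis by (simp only:)
  qed
  also have "\<dots> \<le> v * cmod (s - \<i> * m')"
    using v abs_Im_le_cmod[of "s - \<i> * m'"] by (intro mult_left_mono) auto
  finally show ?thesis unfolding eq m_def[symmetric] by (intro mult_right_mono) auto
qed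

lemma one_minus_semicircle_transform_bounds:
  assumes v: "0 < v" "v \<le> 1" and t: "t > 0"
  shows "0 \<le> 1 - t * semicircle_transform v t" "1 - t * semicircle_transform v t \<le> 2 / (1 + t\<^sup>2)"
proof -
  define r where "r = sqrt (t\<^sup>2 + 4 * v)"
  have r2: "r\<^sup>2 = t\<^sup>2 + 4 * v" using v by (simp add: r_def)
  have rt: "r \<ge> t" unfolding r_def using v by (intro real_le_rsqrt) simp
  have eq: "1 - t * semicircle_transform v t = (r - t)\<^sup>2 / (4 * v)"
    unfolding r_def by (rule one_minus_semicircle_transform[OF v(1)])
  show "0 \<le> 1 - t * semicircle_transform v t" unfolding eq using v by simp
  have "(r - t)\<^sup>2 * (2 * (1 + t\<^sup>2)) \<le> (r - t)\<^sup>2 * ((r + t)\<^sup>2 / v)"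
  proof (intro mult_left_mono)
    have "t * t \<le> t * r" using rt t by (intro mult_left_mono) auto
    hence "4 * t\<^sup>2 + 4 * v \<le> (r + t)\<^sup>2" using r2 by (simp add: power2_eq_square algebra_simps)
    moreover have "v * t\<^sup>2 \<le> 1 * t\<^sup>2" using v by (intro mult_right_mono) auto
    ultimately have "v * (2 * (1 + t\<^sup>2)) \<le> (r + t)\<^sup>2"
      using v zero_le_power2[of t] by (simp only: distrib_left)
    thus "2 * (1 + t\<^sup>2) \<le> (r + t)\<^sup>2 / v" using v by (simp add: pos_le_divide_eq mult.commute)
  qed auto
  also have "(r - t)\<^sup>2 * ((r + t)\<^sup>2 / v) = (r\<^sup>2 - t\<^sup>2)\<^sup>2 / v"
    by (simp add: power2_eq_square algebra_simps)
  also have "\<dots> = 4 * (4 * v)" unfolding r2 using v by (simp add: power2_eq_square)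
  finally have "(r - t)\<^sup>2 * (1 + t\<^sup>2) \<le> 2 * (4 * v)" by (simp add: distrib_left)
  moreover have "1 + t\<^sup>2 > 0" by (intro add_pos_nonneg) auto
  ultimately show "1 - t * semicircle_transform v t \<le> 2 / (1 + t\<^sup>2)"
    unfolding eq using v by (simp add: divide_le_eq pos_le_divide_eq mult_ac)
qed

text \<open>With \<open>a = 2 \<sqrt>v\<close> the integrand is \<open>(sqrt (t\<^sup>2 + a\<^sup>2) - t)\<^sup>2 / a\<^sup>2\<close>, which has an elementary antiderivative
  that vanishes at infinity.  Up to the factor \<open>2 / \<pi>\<close> of Coulson's formula, the value is the mean absolute
  value of the semicircle law.\<close>

lemma has_bochner_integral_semicircle:
  assumes v: "v > 0"
  shows "has_bochner_integral lborel
     (\<lambda>t. indicator {0<..} t *\<^sub>R (1 - t * semicircle_transform v t)) (4 / 3 * sqrt v)"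
proof -
  define a where "a = 2 * sqrt v"
  have a: "a > 0" "4 * v = a\<^sup>2" "sqrt v = a / 2" using v by (auto simp: a_def)
  let ?f = "\<lambda>t. (sqrt (t\<^sup>2 + a\<^sup>2) - t)\<^sup>2 / a\<^sup>2"
  let ?F = "\<lambda>t. (2 * t ^ 3 / 3 + a\<^sup>2 * t - 2 / 3 * ((t\<^sup>2 + a\<^sup>2) * sqrt (t\<^sup>2 + a\<^sup>2))) / a\<^sup>2"
  have "(\<integral>\<^sup>+t. ennreal (?f t) * indicator {0..} t \<partial>lborel) = 0 - ?F 0"
  proof (rule nn_integral_FTC_atLeast)
    show "(?F has_real_derivative ?f t) (at t)" for t
    proof -
      have pos: "t\<^sup>2 + a\<^sup>2 > 0" using a by (intro add_nonneg_pos) auto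
      define r where "r = sqrt (t\<^sup>2 + a\<^sup>2)"
      have r: "r > 0" "r\<^sup>2 = t\<^sup>2 + a\<^sup>2" using pos by (auto simp: r_def)
      have ds: "((\<lambda>t. sqrt (t\<^sup>2 + a\<^sup>2)) has_real_derivative t / r) (at t)"
        unfolding r_def using pos by (auto intro!: derivative_eq_intros simp: field_simps)
      have "(?F has_real_derivative
          (2 * t\<^sup>2 + a\<^sup>2 - 2 / 3 * (2 * t * r + (t\<^sup>2 + a\<^sup>2) * (t / r))) / a\<^sup>2) (at t)"
      proof (rule DERIV_cdivide, rule DERIV_diff)
        show "((\<lambda>t. 2 * t ^ 3 / 3 + a\<^sup>2 * t) has_real_derivative 2 * t\<^sup>2 + a\<^sup>2) (at t)"
          by (auto intro!: derivative_eq_intros)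
        have "((\<lambda>t. t\<^sup>2 + a\<^sup>2) has_real_derivative 2 * t) (at t)"
          by (auto intro!: derivative_eq_intros)
        from DERIV_mult[OF this ds] have "((\<lambda>t. (t\<^sup>2 + a\<^sup>2) * sqrt (t\<^sup>2 + a\<^sup>2)) has_real_derivative
            2 * t * r + (t\<^sup>2 + a\<^sup>2) * (t / r)) (at t)"
          by (simp add: r_def mult_ac)
        thus "((\<lambda>t. 2 / 3 * ((t\<^sup>2 + a\<^sup>2) * sqrt (t\<^sup>2 + a\<^sup>2))) has_real_derivative
            2 / 3 * (2 * t * r + (t\<^sup>2 + a\<^sup>2) * (t / r))) (at t)"
          by (rule DERIV_cmult)
      qed
      also have "(t\<^sup>2 + a\<^sup>2) * (t / r) = t * r"
        unfolding r(2)[symmetric] using r(1) by (simp add: power2_eq_square)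
      also have "2 * t\<^sup>2 + a\<^sup>2 - 2 / 3 * (2 * t * r + t * r) = (r - t)\<^sup>2"
        using r(2) by (simp add: power2_eq_square algebra_simps)
      finally show ?thesis unfolding r_def .
    qed
    show "(?F \<longlongrightarrow> 0) at_top" using a(1) by real_asymp
  qed auto
  also have "0 - ?F 0 = 2 / 3 * a" using a(1) by (simp add: power2_eq_square)
  finally have nn: "(\<integral>\<^sup>+t. ennreal (?f t) * indicator {0..} t \<partial>lborel) = ennreal (2 / 3 * a)" .
  have "has_bochner_integral lborel (\<lambda>t. indicator {0<..} t *\<^sub>R ?f t) (2 / 3 * a)"
  proof (rule has_bochner_integral_nn_integral)
    have "AE t in lborel. t \<noteq> (0::real)" by (rule AE_lborel_singleton)
    hence "AE t in lborel. ennreal (indicator {0<..} t *\<^sub>R ?f t) = ennreal (?f t) * indicator {0..} t"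
      by eventually_elim (auto split: split_indicator)
    thus "(\<integral>\<^sup>+t. ennreal (indicator {0<..} t *\<^sub>R ?f t) \<partial>lborel) = ennreal (2 / 3 * a)"
      unfolding nn[symmetric] by (rule nn_integral_cong_AE)
  qed (use a in auto)
  thus ?thesis unfolding one_minus_semicircle_transform[OF v] a by simp
qed

lemma integrable_one_over_one_plus_square:
  "integrable lborel (\<lambda>t::real. indicator {0<..} t *\<^sub>R (2 / (1 + t\<^sup>2)))"
  using has_bochner_integral_Coulson[of 1, THEN has_bochner_integral_mult_right[where c = 2]]
  by (auto simp: has_bochner_integral_iff mult_ac)

lemma sum_eigenvalues_wigner_le:
  assumes p: "0 \<le> p" "p \<le> 1" and d: "diagonalizes n (wigner n p S) l u"
  shows "(\<Sum>k<n. (l k)\<^sup>2) \<le> real n"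
proof (cases "n = 0")
  case False
  have "(wigner n p S i j)\<^sup>2 \<le> 1 / real n" for i j
  proof -
    have "(of_bool ({Suc i, Suc j} \<in> S) - p)\<^sup>2 \<le> 1" using p by (simp add: abs_square_le_1)
    thus ?thesis by (simp add: wigner_def power_divide divide_right_mono)
  qed
  hence "(\<Sum>i<n. \<Sum>j<n. (wigner n p S i j)\<^sup>2) \<le> (\<Sum>i<n. \<Sum>j<n. 1 / real n)"
    by (intro sum_mono)
  thus ?thesis using False by (simp add: sum_eigenvalues_squared[OF d])
qed simp

lemma expec_abs_le_sqrt:
  fixes F :: "nat set set \<Rightarrow> real"
  shows "expec n p (\<lambda>S. \<bar>F S\<bar>) \<le> sqrt (expec n p (\<lambda>S. (F S)\<^sup>2))"
proof (rule real_le_rsqrt)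
  have "0 \<le> measure_pmf.variance (Gnp n p) (\<lambda>S. \<bar>F S\<bar>)"
    by (rule measure_pmf.variance_positive)
  also have "\<dots> = expec n p (\<lambda>S. \<bar>F S\<bar>\<^sup>2) - (expec n p (\<lambda>S. \<bar>F S\<bar>))\<^sup>2"
    by (rule measure_pmf.variance_eq) auto
  finally show "(expec n p (\<lambda>S. \<bar>F S\<bar>))\<^sup>2 \<le> expec n p (\<lambda>S. (F S)\<^sup>2)" by simp
qed

lemma expec_eq_sum:
  fixes F :: "nat set set \<Rightarrow> real"
  shows "expec n p F = (\<Sum>S\<in>Pow (vertex_pairs n). pmf (Gnp n p) S * F S)"
  by (subst integral_measure_pmf[of "Pow (vertex_pairs n)"])
     (use set_pmf_Gnp in \<open>auto simp: finite_vertex_pairs\<close>)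

lemma expec_integral_swap:
  fixes f :: "nat set set \<Rightarrow> real \<Rightarrow> real"
  assumes "\<And>S. integrable lborel (f S)"
  shows "expec n p (\<lambda>S. \<integral>t. f S t \<partial>lborel) = (\<integral>t. expec n p (\<lambda>S. f S t) \<partial>lborel)"
    and "integrable lborel (\<lambda>t. expec n p (\<lambda>S. f S t))"
  using assms by (simp_all add: expec_eq_sum Bochner_Integration.integral_sum)

lemma Im_stieltjes_nonneg: "t > 0 \<Longrightarrow> Im (stieltjes n l t) \<ge> 0"
  unfolding Im_stieltjes by (intro divide_nonneg_nonneg sum_nonneg) auto

text \<open>The constant in the bound on the residual depends on \<open>t\<close> and grows without bound as \<open>t\<close> tends to \<open>0\<close>, so the
  argument gives convergence only for each \<open>t\<close> separately.\<close>

lemma expectation_stieltjes_tendsto: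
  assumes p: "0 < p" "p < 1" and t: "t > 0"
    and d: "\<And>n S. diagonalizes n (wigner n p S) (l n S) (u n S)"
  shows "(\<lambda>n. expec n p (\<lambda>S. t * \<bar>Im (stieltjes n (l n S) t) - semicircle_transform (p * (1 - p)) t\<bar>)) \<longlonglongrightarrow> 0"
proof -
  define v where "v = p * (1 - p)"
  have v: "v > 0" using p by (simp add: v_def)
  have "\<exists>C. \<forall>n>0. expec n p (\<lambda>S. (cmod (loop_residual v t (stieltjes n (l n S) t)))\<^sup>2) \<le> C / sqrt (real n)"
    unfolding v_def
    by (rule exI, intro allI impI, rule expectation_loop_residual[OF _ _ t _ d]) (use p in simp_all)
  then obtain C where C: "\<And>n. n > 0 \<Longrightarrow>
      expec n p (\<lambda>S. (cmod (loop_residual v t (stieltjes n (l n S) t)))\<^sup>2) \<le> C / sqrt (real n)"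
    by blast
  have bound: "expec n p (\<lambda>S. t * \<bar>Im (stieltjes n (l n S) t) - semicircle_transform v t\<bar>)
      \<le> sqrt (C / sqrt (real n))" if n: "n > 0" for n
  proof -
    have "t * \<bar>Im (stieltjes n (l n S) t) - semicircle_transform v t\<bar>
        \<le> \<bar>cmod (loop_residual v t (stieltjes n (l n S) t))\<bar>" for S
    proof -
      have "\<bar>Im (stieltjes n (l n S) t) - semicircle_transform v t\<bar>
          \<le> cmod (stieltjes n (l n S) t - \<i> * semicircle_transform v t)"
        using abs_Im_le_cmod[of "stieltjes n (l n S) t - \<i> * semicircle_transform v t"] by simp
      hence "t * \<bar>Im (stieltjes n (l n S) t) - semicircle_transform v t\<bar>
          \<le> t * cmod (stieltjes n (l n S) t - \<i> * semicircle_transform v t)"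
        using t by (intro mult_left_mono) auto
      also have "\<dots> \<le> cmod (loop_residual v t (stieltjes n (l n S) t))"
        by (rule semicircle_transform_stability[OF v t Im_stieltjes_nonneg[OF t]])
      finally show ?thesis by simp
    qed
    hence "expec n p (\<lambda>S. t * \<bar>Im (stieltjes n (l n S) t) - semicircle_transform v t\<bar>)
        \<le> expec n p (\<lambda>S. \<bar>cmod (loop_residual v t (stieltjes n (l n S) t))\<bar>)"
      by (intro expec_mono)
    also have "\<dots> \<le> sqrt (expec n p (\<lambda>S. (cmod (loop_residual v t (stieltjes n (l n S) t)))\<^sup>2))"
      by (rule expec_abs_le_sqrt)
    also have "\<dots> \<le> sqrt (C / sqrt (real n))"
      by (rule real_sqrt_le_mono[OF C[OF n]])
    finally show ?thesis .
  qed
  show ?thesis unfolding v_def[symmetric]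
  proof (rule tendsto_sandwich)
    show "\<forall>\<^sub>F n in sequentially. expec n p (\<lambda>S. t * \<bar>Im (stieltjes n (l n S) t) - semicircle_transform v t\<bar>)
      \<le> sqrt (C / sqrt (real n))"
      using eventually_gt_at_top[of 0] by eventually_elim (rule bound)
    show "\<forall>\<^sub>F n in sequentially. 0 \<le> expec n p (\<lambda>S. t * \<bar>Im (stieltjes n (l n S) t) - semicircle_transform v t\<bar>)"
      using t by (intro always_eventually allI Bochner_Integration.integral_nonneg) auto
    have "(\<lambda>n. C / sqrt (real n)) \<longlonglongrightarrow> 0" by real_asymp
    from tendsto_real_sqrt[OF this] show "(\<lambda>n. sqrt (C / sqrt (real n))) \<longlonglongrightarrow> 0" by simp
  qed simp
qed

text \<open>Convergence in mean of the normalized sum of absolute eigenvalues, by dominated convergence in \<open>t\<close> of the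
  expected distance between the two integrands.\<close>

theorem expectation_mean_abs_eigenvalue_tendsto:
  assumes p: "0 < p" "p < 1"
    and d: "\<And>n S. diagonalizes n (wigner n p S) (l n S) (u n S)"
  shows "(\<lambda>n. expec n p (\<lambda>S. \<bar>(\<Sum>k<n. \<bar>l n S k\<bar>) / real n - 8 * sqrt (p * (1 - p)) / (3 * pi)\<bar>)) \<longlonglongrightarrow> 0"
proof -
  define v where "v = p * (1 - p)"
  have v: "0 < v" "v \<le> 1" using p mult_mono[of p 1 "1 - p" 1] by (auto simp: v_def)
  define g where "g = (\<lambda>n S t. indicator {0<..} t *\<^sub>R
      (t * \<bar>Im (stieltjes n (l n S) t) - semicircle_transform v t\<bar>) :: real)"
  have g_eq: "g n S t = \<bar>indicator {0<..} t *\<^sub>R (1 - t * Im (stieltjes n (l n S) t))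
       - indicator {0<..} t *\<^sub>R (1 - t * semicircle_transform v t)\<bar>" for n S t
  proof (cases "t > 0")
    case True
    have "(1 - t * x) - (1 - t * y) = t * (y - x)" for x y by (simp add: algebra_simps)
    thus ?thesis using True by (simp add: g_def abs_mult abs_minus_commute)
  qed (simp add: g_def)
  have g_int: "integrable lborel (g n S)" if "n > 0" for n S
    unfolding g_eq[abs_def]
    using mean_abs_eq_integral_stieltjes(1)[OF that, of "l n S"] has_bochner_integral_semicircle[OF v(1)]
    by (intro integrable_abs Bochner_Integration.integrable_diff)
       (auto simp: set_integrable_def has_bochner_integral_iff)
  have pointwise: "\<bar>(\<Sum>k<n. \<bar>l n S k\<bar>) / real n - 8 * sqrt v / (3 * pi)\<bar> \<le> 2 / pi * (\<integral>t. g n S t \<partial>lborel)"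
    if n: "n > 0" for n S
  proof -
    let ?a = "\<lambda>t. indicator {0<..} t *\<^sub>R (1 - t * Im (stieltjes n (l n S) t)) :: real"
    let ?b = "\<lambda>t. indicator {0<..} t *\<^sub>R (1 - t * semicircle_transform v t) :: real"
    have a: "integrable lborel ?a" "(\<Sum>k<n. \<bar>l n S k\<bar>) / real n = 2 / pi * (\<integral>t. ?a t \<partial>lborel)"
      using mean_abs_eq_integral_stieltjes[OF n, of "l n S"]
      by (auto simp: set_integrable_def set_lebesgue_integral_def)
    have b: "integrable lborel ?b" "(\<integral>t. ?b t \<partial>lborel) = 4 / 3 * sqrt v"
      using has_bochner_integral_semicircle[OF v(1)] by (auto simp: has_bochner_integral_iff)
    have "(\<Sum>k<n. \<bar>l n S k\<bar>) / real n - 8 * sqrt v / (3 * pi)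
        = 2 / pi * ((\<integral>t. ?a t \<partial>lborel) - (\<integral>t. ?b t \<partial>lborel))"
      unfolding a(2) b(2) by (simp add: right_diff_distrib)
    also have "(\<integral>t. ?a t \<partial>lborel) - (\<integral>t. ?b t \<partial>lborel) = (\<integral>t. ?a t - ?b t \<partial>lborel)"
      by (rule Bochner_Integration.integral_diff[symmetric, OF a(1) b(1)])
    finally have "\<bar>(\<Sum>k<n. \<bar>l n S k\<bar>) / real n - 8 * sqrt v / (3 * pi)\<bar> = 2 / pi * \<bar>\<integral>t. ?a t - ?b t \<partial>lborel\<bar>"
      by (simp add: abs_mult)
    also have "\<dots> \<le> 2 / pi * (\<integral>t. \<bar>?a t - ?b t\<bar> \<partial>lborel)"
      by (intro mult_left_mono integral_abs_bound) auto
    finally show ?thesis unfolding g_eq .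
  qed
  have dom: "g n S t \<le> indicator {0<..} t *\<^sub>R (2 / (1 + t\<^sup>2))" if n: "n > 0" for n S t
  proof (cases "t > 0")
    case True
    note l2 = sum_eigenvalues_wigner_le[OF _ _ d, of n S]
    have "0 \<le> 1 - t * Im (stieltjes n (l n S) t)" "1 - t * Im (stieltjes n (l n S) t) \<le> 2 / (1 + t\<^sup>2)"
      using one_minus_Im_stieltjes_bounds[OF n True, of "l n S"] l2 p by auto
    moreover note one_minus_semicircle_transform_bounds[OF v True]
    ultimately show ?thesis unfolding g_eq using True by (simp add: abs_le_iff)
  qed (simp add: g_def)
  have nonneg: "0 \<le> g n S t" for n S t by (simp add: g_eq)
  \<comment> \<open>The domination holds for positive \<open>n\<close> only, hence the shifted sequence.\<close>
  have "(\<lambda>n. \<integral>t. expec (Suc n) p (\<lambda>S. g (Suc n) S t) \<partial>lborel) \<longlonglongrightarrow> (\<integral>t. 0 \<partial>(lborel :: real measure))"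
  proof (rule integral_dominated_convergence)
    show "integrable lborel (\<lambda>t::real. indicator {0<..} t *\<^sub>R (2 / (1 + t\<^sup>2)) :: real)"
      by (rule integrable_one_over_one_plus_square)
    show "(\<lambda>t. expec (Suc n) p (\<lambda>S. g (Suc n) S t)) \<in> borel_measurable lborel" for n
      by (rule borel_measurable_integrable, rule expec_integral_swap(2)) (rule g_int, simp)
    show "AE t in lborel. (\<lambda>n. expec (Suc n) p (\<lambda>S. g (Suc n) S t)) \<longlonglongrightarrow> 0"
    proof (rule AE_I2)
      fix t :: real
      show "(\<lambda>n. expec (Suc n) p (\<lambda>S. g (Suc n) S t)) \<longlonglongrightarrow> 0"
      proof (cases "t > 0")
        case True
        have "(\<lambda>n. expec n p (\<lambda>S. g n S t)) \<longlonglongrightarrow> 0"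
          using expectation_stieltjes_tendsto[OF p True d] True by (simp add: g_def v_def)
        thus ?thesis by (rule LIMSEQ_Suc)
      qed (simp add: g_def)
    qed
    show "AE t in lborel. norm (expec (Suc n) p (\<lambda>S. g (Suc n) S t)) \<le> indicator {0<..} t *\<^sub>R (2 / (1 + t\<^sup>2))" for n
    proof (rule AE_I2)
      fix t :: real
      have "0 \<le> expec (Suc n) p (\<lambda>S. g (Suc n) S t)"
        by (intro Bochner_Integration.integral_nonneg nonneg)
      moreover have "expec (Suc n) p (\<lambda>S. g (Suc n) S t) \<le> expec (Suc n) p (\<lambda>S. indicator {0<..} t *\<^sub>R (2 / (1 + t\<^sup>2)))"
        by (intro expec_mono dom) simp
      ultimately show "norm (expec (Suc n) p (\<lambda>S. g (Suc n) S t)) \<le> indicator {0<..} t *\<^sub>R (2 / (1 + t\<^sup>2))"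
        by simp
    qed
  qed auto
  hence lim: "(\<lambda>n. 2 / pi * (\<integral>t. expec (Suc n) p (\<lambda>S. g (Suc n) S t) \<partial>lborel)) \<longlonglongrightarrow> 0"
    by (auto intro: tendsto_mult_right_zero)
  have "(\<lambda>n. expec (Suc n) p (\<lambda>S. \<bar>(\<Sum>k<Suc n. \<bar>l (Suc n) S k\<bar>) / real (Suc n) - 8 * sqrt v / (3 * pi)\<bar>)) \<longlonglongrightarrow> 0"
  proof (rule tendsto_sandwich[OF _ _ tendsto_const lim])
    show "\<forall>\<^sub>F n in sequentially. 0 \<le> expec (Suc n) p
        (\<lambda>S. \<bar>(\<Sum>k<Suc n. \<bar>l (Suc n) S k\<bar>) / real (Suc n) - 8 * sqrt v / (3 * pi)\<bar>)"
      by (intro always_eventually allI Bochner_Integration.integral_nonneg) auto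
    show "\<forall>\<^sub>F n in sequentially. expec (Suc n) p
        (\<lambda>S. \<bar>(\<Sum>k<Suc n. \<bar>l (Suc n) S k\<bar>) / real (Suc n) - 8 * sqrt v / (3 * pi)\<bar>)
        \<le> 2 / pi * (\<integral>t. expec (Suc n) p (\<lambda>S. g (Suc n) S t) \<partial>lborel)"
    proof (intro always_eventually allI)
      fix n
      have "expec (Suc n) p (\<lambda>S. \<bar>(\<Sum>k<Suc n. \<bar>l (Suc n) S k\<bar>) / real (Suc n) - 8 * sqrt v / (3 * pi)\<bar>)
        \<le> expec (Suc n) p (\<lambda>S. 2 / pi * (\<integral>t. g (Suc n) S t \<partial>lborel))"
        by (intro expec_mono pointwise) simp
      also have "\<dots> = 2 / pi * (\<integral>t. expec (Suc n) p (\<lambda>S. g (Suc n) S t) \<partial>lborel)"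
        by (subst expec_integral_swap(1)[symmetric]) (auto intro: g_int)
      finally show "expec (Suc n) p (\<lambda>S. \<bar>(\<Sum>k<Suc n. \<bar>l (Suc n) S k\<bar>) / real (Suc n) - 8 * sqrt v / (3 * pi)\<bar>)
        \<le> 2 / pi * (\<integral>t. expec (Suc n) p (\<lambda>S. g (Suc n) S t) \<partial>lborel)" .
    qed
  qed
  thus ?thesis unfolding v_def by (rule LIMSEQ_imp_Suc)
qed

section \<open>Degrees and the Lanzhou matrix\<close>

lemma card_incident_pairs:
  assumes "i \<in> {1..n}"
  shows "card {e \<in> vertex_pairs n. i \<in> e} = n - 1"
proof -
  have "{e \<in> vertex_pairs n. i \<in> e} = (\<lambda>j. {i, j}) ` ({1..n} - {i})"
  proof (intro equalityI subsetI)
    fix e assume "e \<in> {e \<in> vertex_pairs n. i \<in> e}"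
    hence e: "e \<subseteq> {1..n}" "card e = 2" "i \<in> e" by (auto simp: vertex_pairs_def)
    then obtain x y where xy: "e = {x, y}" "x \<noteq> y" by (auto simp: card_2_iff)
    with e obtain j where "e = {i, j}" "j \<noteq> i" by auto
    thus "e \<in> (\<lambda>j. {i, j}) ` ({1..n} - {i})" using e by auto
  qed (use assms in \<open>auto simp: vertex_pairs_def\<close>)
  moreover have "inj_on (\<lambda>j. {i, j}) ({1..n} - {i})"
    by (auto simp: inj_on_def doubleton_eq_iff)
  ultimately show ?thesis using assms by (simp add: card_image)
qed

text \<open>Integration by parts shows that distinct centred edge indicators are uncorrelated.\<close>

lemma degree_variance:
  assumes p: "0 \<le> p" "p \<le> 1" and i: "i \<in> {1..n}"
  shows "expec n p (\<lambda>S. (real (degree_in S i) - real (n - 1) * p)\<^sup>2) = real (n - 1) * (p * (1 - p))"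
proof -
  define I where "I = {e \<in> vertex_pairs n. i \<in> e}"
  have I: "finite I" "I \<subseteq> vertex_pairs n" using finite_vertex_pairs by (auto simp: I_def)
  define \<xi> where "\<xi> e S = of_bool (e \<in> S) - p" for e and S :: "nat set set"
  have deg: "real (degree_in S i) - real (n - 1) * p = (\<Sum>e\<in>I. \<xi> e S)" if "S \<in> set_pmf (Gnp n p)" for S
  proof -
    have "S \<subseteq> vertex_pairs n" using that set_pmf_Gnp by blast
    hence "{e \<in> S. i \<in> e} = I \<inter> S" by (auto simp: I_def)
    hence "real (degree_in S i) = (\<Sum>e\<in>I. of_bool (e \<in> S))"
      using I by (simp add: degree_in_def)
    thus ?thesis using card_incident_pairs[OF i] by (simp add: \<xi>_def sum_subtractf I_def)
  qed
  have corr: "expec n p (\<lambda>S. \<xi> e S * \<xi> f S) = p * (1 - p) * of_bool (e = f)" if "e \<in> I" "f \<in> I" for e f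
  proof -
    have "expec n p (\<lambda>S. \<xi> e S * \<xi> f S) = (p * (1 - p)) * expec n p (\<lambda>S. \<xi> f (insert e S) - \<xi> f (S - {e}))"
      using expectation_Gnp_by_parts[OF subsetD[OF I(2) that(1)] p, of "\<xi> f"]
      unfolding \<xi>_def[of e] real_scaleR_def .
    also have "(\<lambda>S. \<xi> f (insert e S) - \<xi> f (S - {e})) = (\<lambda>S. of_bool (e = f))"
      by (auto simp: \<xi>_def)
    finally show ?thesis by simp
  qed
  have "expec n p (\<lambda>S. (real (degree_in S i) - real (n - 1) * p)\<^sup>2)
      = expec n p (\<lambda>S. \<Sum>e\<in>I. \<Sum>f\<in>I. \<xi> e S * \<xi> f S)"
  proof (rule integral_cong_AE)
    show "AE S in measure_pmf (Gnp n p). (real (degree_in S i) - real (n - 1) * p)\<^sup>2 = (\<Sum>e\<in>I. \<Sum>f\<in>I. \<xi> e S * \<xi> f S)"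
      by (rule AE_pmfI) (simp only: deg power2_eq_square sum_product)
  qed auto
  also have "\<dots> = (\<Sum>e\<in>I. \<Sum>f\<in>I. p * (1 - p) * of_bool (e = f))"
    by (simp add: integral_sum corr del: sum_mult_of_bool_eq)
  also have "\<dots> = (\<Sum>e\<in>I. p * (1 - p))"
    using I by (intro sum.cong refl) (simp add: of_bool_def if_distrib cong: if_cong)
  also have "\<dots> = real (n - 1) * (p * (1 - p))" using card_incident_pairs[OF i] by (simp add: I_def)
  finally show ?thesis .
qed

text \<open>The entries as a function of matrix indices, so that the matrix can be compared with \<open>wigner\<close>.\<close>

definition lanzhou_entry :: "nat \<Rightarrow> nat set set \<Rightarrow> nat \<Rightarrow> nat \<Rightarrow> real" where
  "lanzhou_entry n S i j = (if {Suc i, Suc j} \<in> S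
     then (real n - 1) * (real (degree_in S (Suc i)) + real (degree_in S (Suc j)))
        - ((real (degree_in S (Suc i)))\<^sup>2 + (real (degree_in S (Suc j)))\<^sup>2) else 0)"

lemma lanzhou_matrix_eq: "lanzhou_matrix n S = mat n n (\<lambda>(i,j). lanzhou_entry n S i j)"
  by (simp add: lanzhou_matrix_def lanzhou_entry_def Let_def)

lemma lanzhou_entry_sym: "lanzhou_entry n S i j = lanzhou_entry n S j i"
  by (simp add: lanzhou_entry_def insert_commute add.commute)

definition degree_deviation :: "nat \<Rightarrow> real \<Rightarrow> nat set set \<Rightarrow> nat \<Rightarrow> real" where
  "degree_deviation n p S i = real (degree_in S (Suc i)) - (real n - 1) * p"

lemma degree_in_le:
  assumes "S \<subseteq> vertex_pairs n" "i < n"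
  shows "degree_in S (Suc i) \<le> n - 1"
proof -
  have "card {e \<in> S. Suc i \<in> e} \<le> card {e \<in> vertex_pairs n. Suc i \<in> e}"
    using assms by (intro card_mono) (auto simp: finite_vertex_pairs)
  thus ?thesis using card_incident_pairs[of "Suc i" n] assms by (simp add: degree_in_def)
qed

text \<open>With \<open>d = m p + \<delta>\<close> the difference factors as \<open>\<delta> (m (1 - p) - d)\<close>, and the second factor is at most \<open>m\<close>.\<close>

lemma lanzhou_weight_deviation:
  assumes S: "S \<subseteq> vertex_pairs n" and i: "i < n" and p: "0 \<le> p" "p \<le> 1"
  defines "m \<equiv> real n - 1" and "d \<equiv> real (degree_in S (Suc i))"
  shows "\<bar>d * (m - d) - m\<^sup>2 * (p * (1 - p))\<bar> \<le> m * \<bar>degree_deviation n p S i\<bar>"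
proof -
  have m: "0 \<le> m" using i by (simp add: m_def)
  have d: "0 \<le> d" "d \<le> m" using degree_in_le[OF S i] i by (auto simp: d_def m_def)
  have "0 \<le> m * (1 - p)" "m * (1 - p) \<le> m" using m p by (auto simp: mult_left_le)
  hence "\<bar>m * (1 - p) - d\<bar> \<le> m" using d by linarith
  moreover have "d * (m - d) - m\<^sup>2 * (p * (1 - p)) = degree_deviation n p S i * (m * (1 - p) - d)"
    by (simp add: degree_deviation_def d_def[symmetric] m_def[symmetric] power2_eq_square algebra_simps)
  ultimately show ?thesis
    using mult_right_mono[of "\<bar>m * (1 - p) - d\<bar>" m "\<bar>degree_deviation n p S i\<bar>"]
    by (simp add: abs_mult mult.commute)
qed

text \<open>The comparison matrix is \<open>K \<sqrt>n\<close> times the Wigner matrix.  The difference consists of the deviations \<open>h\<close> of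
  the edge weights from \<open>K\<close> and of the constant \<open>K p\<close> off the diagonal, the mean of \<open>K\<close> times the adjacency
  matrix.\<close>

lemma lanzhou_energy_approximation:
  assumes S: "S \<subseteq> vertex_pairs n" and n: "n > 0" and p: "0 \<le> p" "p \<le> 1"
    and d: "diagonalizes n (wigner n p S) l u"
  defines "K \<equiv> 2 * (real n - 1)\<^sup>2 * (p * (1 - p))"
  shows "\<bar>matrix_energy (lanzhou_matrix n S) - K * sqrt (real n) * (\<Sum>k<n. \<bar>l k\<bar>)\<bar>
    \<le> 2 * (real n)\<^sup>2 * sqrt (\<Sum>i<n. (degree_deviation n p S i)\<^sup>2) + 4 * real n ^ 3"
proof -
  define m where "m = real n - 1"
  define dev where "dev = degree_deviation n p S"
  define c where "c = K * sqrt (real n)"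
  have m: "0 \<le> m" "m \<le> real n" using n by (auto simp: m_def)
  have v: "0 \<le> p * (1 - p)" "p * (1 - p) \<le> 1" using p mult_mono[of p 1 "1 - p" 1] by auto
  have K: "0 \<le> K" "K \<le> 2 * (real n)\<^sup>2"
  proof -
    show "0 \<le> K" using v by (simp add: K_def)
    have "2 * m\<^sup>2 * (p * (1 - p)) \<le> 2 * (real n)\<^sup>2 * 1"
      using m v by (intro mult_mono power_mono) auto
    thus "K \<le> 2 * (real n)\<^sup>2" by (simp add: K_def m_def)
  qed
  obtain l' u' where L: "diagonalizes n (lanzhou_entry n S) l' u'"
    and E: "matrix_energy (lanzhou_matrix n S) = (\<Sum>k<n. \<bar>l' k\<bar>)"
    unfolding lanzhou_matrix_eq using symmetric_spectral_theorem[of n "lanzhou_entry n S"] lanzhou_entry_sym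
    by metis
  have W: "diagonalizes n (\<lambda>i j. c * wigner n p S i j) (\<lambda>k. c * l k) u"
    using d by (simp add: diagonalizes_def sum_distrib_left mult_ac)
  define h where "h i j = (if {Suc i, Suc j} \<in> S then lanzhou_entry n S i j - K else 0)" for i j
  have split: "lanzhou_entry n S i j = c * wigner n p S i j + h i j + (K * p - K * p * of_bool (i = j))"
    if ij: "i < n" "j < n" for i j
  proof (cases "i = j")
    case True
    hence "{Suc i, Suc j} \<notin> S" using S by (auto simp: vertex_pairs_def)
    thus ?thesis using True by (simp add: lanzhou_entry_def h_def wigner_def)
  next
    case False
    hence "c * wigner n p S i j = K * (of_bool ({Suc i, Suc j} \<in> S) - p)"
      using n by (simp add: wigner_def c_def)
    thus ?thesis using False by (simp add: lanzhou_entry_def h_def algebra_simps)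
  qed
  have h: "(h i j)\<^sup>2 \<le> 2 * m\<^sup>2 * ((dev i)\<^sup>2 + (dev j)\<^sup>2)" if ij: "i < n" "j < n" for i j
  proof (cases "{Suc i, Suc j} \<in> S")
    case True
    define f where "f i = real (degree_in S (Suc i)) * (m - real (degree_in S (Suc i))) - m\<^sup>2 * (p * (1 - p))" for i
    have "h i j = f i + f j"
      using True by (simp add: h_def lanzhou_entry_def f_def K_def m_def[symmetric] power2_eq_square algebra_simps)
    moreover have "\<bar>f i\<bar> \<le> m * \<bar>dev i\<bar>" "\<bar>f j\<bar> \<le> m * \<bar>dev j\<bar>"
      unfolding f_def m_def dev_def by (intro lanzhou_weight_deviation S ij p)+
    hence "(f i)\<^sup>2 \<le> (m * dev i)\<^sup>2" "(f j)\<^sup>2 \<le> (m * dev j)\<^sup>2"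
      using m by (simp_all add: abs_le_square_iff[symmetric] abs_mult)
    moreover have "(f i + f j)\<^sup>2 \<le> 2 * ((f i)\<^sup>2 + (f j)\<^sup>2)"
      using zero_le_power2[of "f i - f j"] by (simp add: power2_eq_square algebra_simps)
    ultimately show ?thesis by (simp add: power_mult_distrib algebra_simps)
  qed (simp add: h_def)
  have "(\<Sum>i<n. \<Sum>j<n. (h i j)\<^sup>2) \<le> (\<Sum>i<n. \<Sum>j<n. 2 * m\<^sup>2 * ((dev i)\<^sup>2 + (dev j)\<^sup>2))"
    by (intro sum_mono h) auto
  also have "\<dots> = 4 * m\<^sup>2 * real n * (\<Sum>i<n. (dev i)\<^sup>2)"
    by (simp add: sum.distrib distrib_left flip: sum_distrib_left)
  also have "\<dots> \<le> 4 * (real n)\<^sup>2 * real n * (\<Sum>i<n. (dev i)\<^sup>2)"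
    using m by (intro mult_right_mono mult_left_mono power_mono sum_nonneg) auto
  finally have "real n * (\<Sum>i<n. \<Sum>j<n. (h i j)\<^sup>2) \<le> (2 * (real n)\<^sup>2)\<^sup>2 * (\<Sum>i<n. (dev i)\<^sup>2)"
    using mult_left_mono[of _ _ "real n"] by (fastforce simp: power2_eq_square mult_ac)
  hence "sqrt (real n * (\<Sum>i<n. \<Sum>j<n. (h i j)\<^sup>2)) \<le> sqrt ((2 * (real n)\<^sup>2)\<^sup>2 * (\<Sum>i<n. (dev i)\<^sup>2))"
    by (rule real_sqrt_le_mono)
  also have "\<dots> = 2 * (real n)\<^sup>2 * sqrt (\<Sum>i<n. (dev i)\<^sup>2)"
    unfolding real_sqrt_mult by (subst real_sqrt_abs) simp
  finally have F: "sqrt (real n * (\<Sum>i<n. \<Sum>j<n. (h i j)\<^sup>2)) \<le> 2 * (real n)\<^sup>2 * sqrt (\<Sum>i<n. (dev i)\<^sup>2)" .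
  have "K * p \<le> 2 * (real n)\<^sup>2 * 1" using K p by (intro mult_mono) auto
  hence "2 * \<bar>K * p\<bar> * real n \<le> 2 * (2 * (real n)\<^sup>2) * real n"
    using K p by (intro mult_right_mono) (auto simp: abs_mult)
  hence R: "2 * \<bar>K * p\<bar> * real n \<le> 4 * real n ^ 3" by (simp add: power2_eq_square power3_eq_cube)
  have cl: "(\<Sum>k<n. \<bar>c * l k\<bar>) = K * sqrt (real n) * (\<Sum>k<n. \<bar>l k\<bar>)"
    using K by (simp add: abs_mult c_def sum_distrib_left)
  show ?thesis
    using order_trans[OF sum_abs_eigenvalues_perturbation[OF L W split] add_mono[OF F R]]
    unfolding cl E dev_def .
qed

lemma expectation_degree_deviation:
  assumes p: "0 \<le> p" "p \<le> 1" and n: "n > 0"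
  shows "expec n p (\<lambda>S. sqrt (\<Sum>i<n. (degree_deviation n p S i)\<^sup>2)) \<le> real n"
proof -
  have v: "0 \<le> p * (1 - p)" "p * (1 - p) \<le> 1" using p mult_mono[of p 1 "1 - p" 1] by auto
  have var: "expec n p (\<lambda>S. (degree_deviation n p S i)\<^sup>2) \<le> real n" if "i < n" for i
  proof -
    have "expec n p (\<lambda>S. (degree_deviation n p S i)\<^sup>2) = real (n - 1) * (p * (1 - p))"
      using degree_variance[OF p, of "Suc i" n] that by (simp add: degree_deviation_def of_nat_diff)
    also have "\<dots> \<le> real n * 1" using v by (intro mult_mono) auto
    finally show ?thesis by simp
  qed
  let ?F = "\<lambda>S. sqrt (\<Sum>i<n. (degree_deviation n p S i)\<^sup>2)"
  have nn: "0 \<le> (\<Sum>i<n. (degree_deviation n p S i)\<^sup>2)" for S by (intro sum_nonneg) auto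
  have "expec n p ?F \<le> sqrt (expec n p (\<lambda>S. (?F S)\<^sup>2))"
    using expec_abs_le_sqrt[of n p ?F] nn by simp
  also have "expec n p (\<lambda>S. (?F S)\<^sup>2) = (\<Sum>i<n. expec n p (\<lambda>S. (degree_deviation n p S i)\<^sup>2))"
    using nn by (simp add: Bochner_Integration.integral_sum)
  also have "sqrt \<dots> \<le> sqrt (\<Sum>i<n. real n)"
    by (intro real_sqrt_le_mono sum_mono var) auto
  also have "\<dots> = real n" by simp
  finally show ?thesis .
qed

lemma prob_Gnp_Markov:
  assumes "\<epsilon> > 0"
  shows "measure_pmf.prob (Gnp n p) {S. \<bar>Y S\<bar> > \<epsilon>} \<le> expec n p (\<lambda>S. \<bar>Y S\<bar>) / \<epsilon>"
proof -
  have "measure_pmf.prob (Gnp n p) {S. \<bar>Y S\<bar> > \<epsilon>} = expec n p (indicator {S. \<bar>Y S\<bar> > \<epsilon>})"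
    by simp
  also have "\<dots> \<le> expec n p (\<lambda>S. \<bar>Y S\<bar> / \<epsilon>)"
    using assms by (intro expec_mono) (auto split: split_indicator simp: field_simps)
  finally show ?thesis by simp
qed

theorem corollary15:
  fixes p :: real
  assumes "0 < p" and "p < 1"
  shows "\<forall>\<epsilon>>0. (\<lambda>n. measure_pmf.prob (Gnp n p)
           {E. \<bar>matrix_energy (lanzhou_matrix n E) /
                 (16 / (3 * pi) * (p * (1 - p)) powr (3/2) * real n powr (7/2)) - 1\<bar> > \<epsilon>})
         \<longlonglongrightarrow> 0"
proof (intro allI impI)
  fix \<epsilon> :: real assume \<epsilon>: "\<epsilon> > 0"
  define v where "v = p * (1 - p)"
  have v: "v > 0" using assms by (simp add: v_def)
  have "\<exists>l u. diagonalizes n (wigner n p S) l u" for n S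
    using symmetric_spectral_theorem[of n "wigner n p S"] wigner_sym by metis
  then obtain l u where d: "\<And>n S. diagonalizes n (wigner n p S) (l n S) (u n S)"
    by metis
  define c where "c = 8 * sqrt v / (3 * pi)"
  have c: "c > 0" using v by (simp add: c_def)
  define g where "g n = 16 / (3 * pi) * v powr (3/2) * real n powr (7/2)" for n
  define x where "x n S = (\<Sum>k<n. \<bar>l n S k\<bar>) / real n" for n S
  define Y where "Y n S = matrix_energy (lanzhou_matrix n S) / g n - 1" for n S
  define bound where "bound n = 6 * real n ^ 3 / g n + expec n p (\<lambda>S. \<bar>x n S - c\<bar>) / c
      + (1 - ((real n - 1) / real n)\<^sup>2)" for n
  have EY: "expec n p (\<lambda>S. \<bar>Y n S\<bar>) \<le> bound n" if n: "n > 0" for n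
  proof -
    define r where "r = ((real n - 1) / real n)\<^sup>2"
    define K where "K = 2 * (real n - 1)\<^sup>2 * v"
    define D where "D S = sqrt (\<Sum>i<n. (degree_deviation n p S i)\<^sup>2)" for S
    have r: "0 \<le> r" "r \<le> 1" using n by (auto simp: r_def power_le_one)
    have g_pos: "g n > 0" using n v by (simp add: g_def)
    have g_eq: "g n = 2 * (real n)\<^sup>2 * v * sqrt (real n) * real n * c"
    proof -
      have "v powr (3/2) = v * sqrt v"
        using v powr_add[of v 1 "1/2"] by (simp add: powr_half_sqrt)
      moreover have "real n powr (7/2) = real n ^ 3 * sqrt (real n)"
        using n powr_add[of "real n" 3 "1/2"] by (simp add: powr_half_sqrt powr_numeral)
      ultimately show ?thesis by (simp add: g_def c_def power2_eq_square power3_eq_cube)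
    qed
    have main: "K * sqrt (real n) * (\<Sum>k<n. \<bar>l n S k\<bar>) / g n = r * (x n S / c)" for S
      unfolding g_eq K_def r_def x_def using n v c by (simp add: field_simps power2_eq_square)
    have pointwise: "\<bar>Y n S\<bar> \<le> (2 * (real n)\<^sup>2 * D S + 4 * real n ^ 3) / g n + \<bar>x n S - c\<bar> / c + (1 - r)"
      if "S \<in> set_pmf (Gnp n p)" for S
    proof -
      have S: "S \<subseteq> vertex_pairs n" using that set_pmf_Gnp by blast
      define e where "e = matrix_energy (lanzhou_matrix n S) - K * sqrt (real n) * (\<Sum>k<n. \<bar>l n S k\<bar>)"
      have e: "\<bar>e\<bar> \<le> 2 * (real n)\<^sup>2 * D S + 4 * real n ^ 3"
        unfolding e_def K_def D_def v_def using assms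
        by (intro lanzhou_energy_approximation[OF S n _ _ d]) auto
      have "Y n S = e / g n + r * (x n S / c - 1) - (1 - r)"
        using main[of S] by (simp add: Y_def e_def diff_divide_distrib algebra_simps)
      moreover have "\<bar>a + b - b'\<bar> \<le> \<bar>a\<bar> + \<bar>b\<bar> + b'" if "0 \<le> b'" for a b b' :: real
        using that by linarith
      ultimately have "\<bar>Y n S\<bar> \<le> \<bar>e / g n\<bar> + \<bar>r * (x n S / c - 1)\<bar> + (1 - r)"
        using r(2) by (simp only: diff_ge_0_iff_ge)
      also have "\<bar>e / g n\<bar> \<le> (2 * (real n)\<^sup>2 * D S + 4 * real n ^ 3) / g n"
        using e g_pos by (simp add: divide_right_mono)
      also have "\<bar>r * (x n S / c - 1)\<bar> \<le> 1 * \<bar>x n S / c - 1\<bar>"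
        unfolding abs_mult using r by (intro mult_right_mono) auto
      also have "x n S / c - 1 = (x n S - c) / c" using c by (simp add: diff_divide_distrib)
      finally show ?thesis using c by simp
    qed
    have "expec n p (\<lambda>S. \<bar>Y n S\<bar>)
        \<le> expec n p (\<lambda>S. (2 * (real n)\<^sup>2 * D S + 4 * real n ^ 3) / g n + \<bar>x n S - c\<bar> / c + (1 - r))"
      by (intro expec_mono pointwise)
    also have "\<dots> = (2 * (real n)\<^sup>2 * expec n p D + 4 * real n ^ 3) / g n
        + expec n p (\<lambda>S. \<bar>x n S - c\<bar>) / c + (1 - r)"
      by simp
    also have "\<dots> \<le> (2 * (real n)\<^sup>2 * real n + 4 * real n ^ 3) / g n
        + expec n p (\<lambda>S. \<bar>x n S - c\<bar>) / c + (1 - r)"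
      using g_pos assms expectation_degree_deviation[of p n] n
      by (intro add_right_mono divide_right_mono mult_left_mono) (auto simp: D_def[abs_def])
    finally show ?thesis by (simp add: bound_def r_def power2_eq_square power3_eq_cube)
  qed
  have "(\<lambda>n. bound n / \<epsilon>) \<longlonglongrightarrow> (0 + 0 / c + 0) / \<epsilon>"
    unfolding bound_def
  proof (intro tendsto_divide tendsto_add tendsto_const)
    have "(\<lambda>n. 6 * real n ^ 3 / (a * real n powr (7/2))) \<longlonglongrightarrow> 0" if "a > 0" for a
      using that by real_asymp
    from this[of "16 / (3 * pi) * v powr (3/2)"] show "(\<lambda>n. 6 * real n ^ 3 / g n) \<longlonglongrightarrow> 0"
      unfolding g_def using v by (simp only: mult_pos_pos divide_pos_pos zero_less_numeral pi_gt_zero powr_gt_zero)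
    show "(\<lambda>n. expec n p (\<lambda>S. \<bar>x n S - c\<bar>)) \<longlonglongrightarrow> 0"
      unfolding x_def c_def v_def by (rule expectation_mean_abs_eigenvalue_tendsto[OF assms d])
    show "(\<lambda>n. 1 - ((real n - 1) / real n)\<^sup>2) \<longlonglongrightarrow> 0" by real_asymp
  qed (use c \<epsilon> in auto)
  hence lim: "(\<lambda>n. bound n / \<epsilon>) \<longlonglongrightarrow> 0" by simp
  have "(\<lambda>n. measure_pmf.prob (Gnp n p) {S. \<bar>Y n S\<bar> > \<epsilon>}) \<longlonglongrightarrow> 0"
  proof (rule tendsto_sandwich[OF _ _ tendsto_const lim])
    show "\<forall>\<^sub>F n in sequentially. measure_pmf.prob (Gnp n p) {S. \<bar>Y n S\<bar> > \<epsilon>} \<le> bound n / \<epsilon>"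
      using eventually_gt_at_top[of 0]
    proof eventually_elim
      case (elim n)
      have "measure_pmf.prob (Gnp n p) {S. \<bar>Y n S\<bar> > \<epsilon>} \<le> expec n p (\<lambda>S. \<bar>Y n S\<bar>) / \<epsilon>"
        by (rule prob_Gnp_Markov[OF \<epsilon>])
      also have "\<dots> \<le> bound n / \<epsilon>" using EY[OF elim] \<epsilon> by (intro divide_right_mono) auto
      finally show ?case .
    qed
  qed simp
  thus "(\<lambda>n. measure_pmf.prob (Gnp n p)
           {E. \<bar>matrix_energy (lanzhou_matrix n E) /
                 (16 / (3 * pi) * (p * (1 - p)) powr (3/2) * real n powr (7/2)) - 1\<bar> > \<epsilon>})
         \<longlonglongrightarrow> 0"
    by (simp add: Y_def g_def v_def)
qed

end
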